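(* For all $n\ge1$, $$\sum_{\sigma\in\mathcal X_{2n}}p^{(2\text{-}31)\sigma}q^{(31\text{-}2)\sigma}t^{\mathrm{des}\,\sigma}=\sum_{k=0}^{\lfloor n/2\rfloor}\gamma_{n,k}(p,q)\,t^k(1+t)^{n-2k},$$ with coefficients $$\gamma_{n,k}(p,q)=\sum_{\sigma\in\overline{\mathcal X}_{2n,k}}p^{(2\text{-}31)\sigma}q^{(31\text{-}2)\sigma}.$$ Moreover, the $\gamma$-coefficients factorize as $$\gamma_{n,k}(p,q)=(p+q)^{2k}\sum_{\sigma\in\widehat{\mathcal X}_{2n,k}}q^{(31\text{-}2)\sigma-k}\,p^{(2\text{-}31)\sigma-k}.$$
   Context: Permutations $\sigma\in\mathfrak S_m$ of $[m]=\{1,\dots,m\}$ are written as words $\sigma_1\cdots\sigma_m$. A descent of $\sigma$ is a pair $(\sigma_i,\sigma_{i+1})$ with $\sigma_i>\sigma_{i+1}$; $\sigma_i$ is the descent top and $\sigma_{i+1}$ the descent bottom; $\mathrm{des}\,\sigma$ is the number of descents. A descent is even-odd if its top is even and its bottom is odd. $\mathcal X_{2n}$ is the set of $\sigma\in\mathfrak S_{2n}$ all of whose descents are even-odd. $\overline{\mathcal X}_{2n}$ (the set of $\mathcal E$-permutations) is the set of $\sigma\in\mathcal X_{2n}$ such that for no $j\in[n]$ are $2j-1$ and $2j$ simultaneously a descent bottom and a descent top of $\sigma$; $\overline{\mathcal X}_{2n,k}=\{\sigma\in\overline{\mathcal X}_{2n}:\mathrm{des}\,\sigma=k\}$. For $\sigma\in\mathfrak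 S_m$, $(31\text{-}2)\sigma$ is the number of pairs $(i,j)$ with $2\le i<j\le m$ and $\sigma_{i-1}>\sigma_j>\sigma_i$; $(2\text{-}31)\sigma$ is the number of pairs $(i,j)$ with $1\le i<j\le m-1$ and $\sigma_j>\sigma_i>\sigma_{j+1}$. For a value $v=\sigma_j$: $l_\sigma(v)$ is the number of $i$ with $2\le i<j$ and $\sigma_{i-1}>v>\sigma_i$; $r_\sigma(v)$ is the number of $i$ with $j<i\le m-1$ and $\sigma_i>v>\sigma_{i+1}$. For $\sigma\in\mathcal X_{2n}$, $S_\sigma\subseteq[2n]$ is the set of all descent tops and descent bottoms of $\sigma$. For $x\in[2n]$, let $S_o(x)$ and $S_e(x)$ be the numbers of odd and even elements of $S_\sigma$ that are less than $x$, and set $s(x)=S_o(x)-S_e(x)+\epsilon$, where $\epsilon=1$ if $x\notin S_\sigma$ or $x$ is an odd element of $S_\sigma$, and $\epsilon=0$ if $x$ is an even element of $S_\sigma$. $\sigma\in\overline{\mathcal X}_{2n}$ is normalized if for every $j\in[n]$: (a) if $2j-1\in S_\sigma$ and $s(2j-1)$ is odd, then $l_\sigma(2j)$ is even; (b) if $2j-1\in S_\sigma$ and $s(2j-1)$ is even, then $l_\sigma(2j-1)$ is even; (c) if $2j\in S_\sigma$ and $s(2j)$ is odd, then $r_\sigma(2j-1)$ is even; (d) if $2j\in S_\sigma$ and $s(2j)$ is even, then $r_\sigma(2j)$ is even. $\widehat{\mathcal X}_{2n}$ is the set of normalized $\sigma\in\overline{\mathcal X}_{2n}$ and $\widehat{\mathcal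 X}_{2n,k}=\{\sigma\in\widehat{\mathcal X}_{2n}:\mathrm{des}\,\sigma=k\}$. *)

theory Defs
  imports Complex_Main "HOL-Combinatorics.Permutations"
begin

(* A permutation s of {1..m} is a function with s permutes {1..m}; its word is s 1, ..., s m.
   The length m is an explicit argument wherever the last position of the word matters. *)

definition descents :: "nat \<Rightarrow> (nat \<Rightarrow> nat) \<Rightarrow> (nat \<times> nat) set" where
  "descents m \<sigma> = {(\<sigma> i, \<sigma> (i + 1)) | i. 1 \<le> i \<and> i < m \<and> \<sigma> i > \<sigma> (i + 1)}"

definition des :: "nat \<Rightarrow> (nat \<Rightarrow> nat) \<Rightarrow> nat" where
  "des m \<sigma> = card (descents m \<sigma>)"

definition tops :: "nat \<Rightarrow> (nat \<Rightarrow> nat) \<Rightarrow> nat set" where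
  "tops m \<sigma> = fst ` descents m \<sigma>"

definition bottoms :: "nat \<Rightarrow> (nat \<Rightarrow> nat) \<Rightarrow> nat set" where
  "bottoms m \<sigma> = snd ` descents m \<sigma>"

definition stat_31_2 :: "nat \<Rightarrow> (nat \<Rightarrow> nat) \<Rightarrow> nat" where
  "stat_31_2 m \<sigma> =
     card {(i, j). 2 \<le> i \<and> i < j \<and> j \<le> m \<and> \<sigma> (i - 1) > \<sigma> j \<and> \<sigma> j > \<sigma> i}"

definition stat_2_31 :: "nat \<Rightarrow> (nat \<Rightarrow> nat) \<Rightarrow> nat" where
  "stat_2_31 m \<sigma> =
     card {(i, j). 1 \<le> i \<and> i < j \<and> j \<le> m - 1 \<and> \<sigma> j > \<sigma> i \<and> \<sigma> i > \<sigma> (j + 1)}"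

(* The argument v of lstat and rstat is a value; its position in the word is inv s v. *)

definition lstat :: "(nat \<Rightarrow> nat) \<Rightarrow> nat \<Rightarrow> nat" where
  "lstat \<sigma> v = card {i. 2 \<le> i \<and> i < inv \<sigma> v \<and> \<sigma> (i - 1) > v \<and> v > \<sigma> i}"

definition rstat :: "nat \<Rightarrow> (nat \<Rightarrow> nat) \<Rightarrow> nat \<Rightarrow> nat" where
  "rstat m \<sigma> v = card {i. inv \<sigma> v < i \<and> i \<le> m - 1 \<and> \<sigma> i > v \<and> v > \<sigma> (i + 1)}"

(* From here on the argument n stands for permutations of {1..2n}. *)

definition X_perms :: "nat \<Rightarrow> (nat \<Rightarrow> nat) set" where
  "X_perms n = {\<sigma>. \<sigma> permutes {1..2 * n} \<and> (\<forall>(a, b) \<in> descents (2 * n) \<sigma>. even a \<and> odd b)}"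

definition E_perms :: "nat \<Rightarrow> (nat \<Rightarrow> nat) set" where
  "E_perms n = {\<sigma> \<in> X_perms n.
     \<not> (\<exists>j \<in> {1..n}. 2 * j - 1 \<in> bottoms (2 * n) \<sigma> \<and> 2 * j \<in> tops (2 * n) \<sigma>)}"

definition E_perms_des :: "nat \<Rightarrow> nat \<Rightarrow> (nat \<Rightarrow> nat) set" where
  "E_perms_des n k = {\<sigma> \<in> E_perms n. des (2 * n) \<sigma> = k}"

definition S_set :: "nat \<Rightarrow> (nat \<Rightarrow> nat) \<Rightarrow> nat set" where
  "S_set n \<sigma> = tops (2 * n) \<sigma> \<union> bottoms (2 * n) \<sigma>"

definition s_val :: "nat \<Rightarrow> (nat \<Rightarrow> nat) \<Rightarrow> nat \<Rightarrow> int" where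
  "s_val n \<sigma> x =
     int (card {y \<in> S_set n \<sigma>. odd y \<and> y < x}) - int (card {y \<in> S_set n \<sigma>. even y \<and> y < x})
     + (if x \<in> S_set n \<sigma> \<and> even x then 0 else 1)"

definition normalized :: "nat \<Rightarrow> (nat \<Rightarrow> nat) \<Rightarrow> bool" where
  "normalized n \<sigma> \<longleftrightarrow> (\<forall>j \<in> {1..n}.
     (2 * j - 1 \<in> S_set n \<sigma> \<and> odd (s_val n \<sigma> (2 * j - 1)) \<longrightarrow> even (lstat \<sigma> (2 * j))) \<and>
     (2 * j - 1 \<in> S_set n \<sigma> \<and> even (s_val n \<sigma> (2 * j - 1)) \<longrightarrow> even (lstat \<sigma> (2 * j - 1))) \<and>
     (2 * j \<in> S_set n \<sigma> \<and> odd (s_val n \<sigma> (2 * j)) \<longrightarrow> even (rstat (2 * n) \<sigma> (2 * j - 1))) \<and>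
     (2 * j \<in> S_set n \<sigma> \<and> even (s_val n \<sigma> (2 * j)) \<longrightarrow> even (rstat (2 * n) \<sigma> (2 * j))))"

definition N_perms_des :: "nat \<Rightarrow> nat \<Rightarrow> (nat \<Rightarrow> nat) set" where
  "N_perms_des n k = {\<sigma> \<in> E_perms n. normalized n \<sigma> \<and> des (2 * n) \<sigma> = k}"

definition gamma_coeff :: "nat \<Rightarrow> nat \<Rightarrow> 'a::comm_ring_1 \<Rightarrow> 'a \<Rightarrow> 'a" where
  "gamma_coeff n k p q =
     (\<Sum>\<sigma> \<in> E_perms_des n k. p ^ stat_2_31 (2 * n) \<sigma> * q ^ stat_31_2 (2 * n) \<sigma>)"

end

theory Submission
  imports Defs
begin

text \<open>
  The idea is to build a permutation of \<open>\<X>\<^sub>2\<^sub>n\<close> by inserting the values \<open>1, 2, \<dots>, 2n\<close> in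
  increasing order, as in the Francon--Viennot correspondence. After the values up to \<open>v\<close> have
  been inserted, the word consists of these values and of place holders \<open>\<infinity>\<close>, each standing for a
  maximal run of larger values, where the end of the word counts as a larger value. The next value
  \<open>x\<close> is put next to one of the place holders (or replaces it), and the number of place holders to
  the left of the chosen one is exactly \<open>l\<^sub>\<sigma>(x)\<close>. Since all descents are even-odd, whether \<open>x\<close> belongs to \<open>S\<^sub>\<sigma>\<close>
  determines the kind of insertion: an odd element of \<open>S\<^sub>\<sigma>\<close> creates a place holder, an even one
  consumes one, and any other value leaves their number unchanged. Hence the number of positions
  available for \<open>x\<close> is \<open>s(x)\<close>, one has \<open>l\<^sub>\<sigma>(x) + r\<^sub>\<sigma>(x) + 1 = s(x)\<close>, and for a fixed set \<open>S\<close> the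
  numbers \<open>l\<^sub>\<sigma>(x) < s(x)\<close> can be prescribed arbitrarily and independently
  (\<open>partial_word_unique_existence\<close>, \<open>lstat_bij_betw_fibre\<close>). Consequently the permutations with
  \<open>S\<^sub>\<sigma> = S\<close> contribute the product of the \<open>(p,q)\<close>-integers \<open>[s(x)]\<close> over all \<open>x\<close>
  (\<open>fibre_weight\<close>).

  For the \<open>\<gamma>\<close>-expansion, adding a whole pair \<open>{2j-1, 2j}\<close> to a set \<open>S\<close> disjoint from it changes no
  value \<open>s(x)\<close> and adds one descent. So the sets \<open>S\<close> are grouped by what remains after the
  removal of all complete pairs; a remaining set \<open>T\<close> with \<open>k\<close> odd elements belongs to
  \<open>\<E>\<close>-permutations, leaves \<open>n - 2k\<close> pairs free, and its group contributes
  \<open>t\<^sup>k (1 + t)\<^sup>n\<^sup>-\<^sup>2\<^sup>k\<close> times the weight of \<open>T\<close> (\<open>sum_balanced_eq_sum_sparse\<close>).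

  For the factorization, each of the \<open>2k\<close> pairs that meet such a \<open>T\<close> in one element contains exactly
  one \<open>v\<close> with \<open>s(v)\<close> even, because the two values of \<open>s\<close> on the pair differ by one. Then
  \<open>[s(v)]\<close> is divisible by \<open>p + q\<close>, and the quotient is the sum over half of the choices of
  \<open>l(v)\<close>. The parity conditions defining normalized permutations select exactly these halves
  (\<open>normalized_iff\<close>, \<open>sum_normal_weight\<close>), with a spare factor \<open>p\<close> when the pair meets \<open>T\<close> in its
  odd element and a spare factor \<open>q\<close> when it does so in its even element, which accounts for the
  shift of both exponents by \<open>k\<close>.
\<close>

section \<open>Counting adjacent pairs in words\<close>

definition adj_count :: "(nat \<Rightarrow> nat \<Rightarrow> bool) \<Rightarrow> nat list \<Rightarrow> nat" where
  "adj_count P xs = length (filter (\<lambda>(a, b). P a b) (zip xs (tl xs)))"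

lemma adj_count_simps [simp]:
  "adj_count P [] = 0"
  "adj_count P [a] = 0"
  "adj_count P (a # b # xs) = (if P a b then 1 else 0) + adj_count P (b # xs)"
  by (auto simp: adj_count_def)

lemma adj_count_card:
  "adj_count P xs = card {i. Suc i < length xs \<and> P (xs ! i) (xs ! Suc i)}"
  unfolding adj_count_def length_filter_conv_card
  by (rule arg_cong[of _ _ card]) (auto simp: nth_tl less_diff_conv)

lemma adj_count_append:
  assumes "\<And>a. \<not> P a z"
  shows "adj_count P (X @ z # Z) = adj_count P X + adj_count P (z # Z)"
  using assms by (induction X rule: induct_list012) auto

lemma adj_count_Cons:
  assumes "\<And>b. \<not> P a b"
  shows "adj_count P (a # xs) = adj_count P xs"
  using assms by (cases xs) auto

text \<open>
  Such a predicate cannot tell two letters above \<open>u\<close> apart when they stand first in a pair, and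
  never holds with such a letter in second place. All the predicates below that describe the
  position of \<open>u\<close> relative to descents are of this kind.
\<close>
definition blind_above :: "nat \<Rightarrow> (nat \<Rightarrow> nat \<Rightarrow> bool) \<Rightarrow> bool" where
  "blind_above u P \<longleftrightarrow>
     (\<forall>z>u. (\<forall>a. \<not> P a z) \<and> (\<forall>z'>u. \<forall>b. P z b = P z' b))"

lemma blind_aboveD1: "blind_above u P \<Longrightarrow> u < z \<Longrightarrow> \<not> P a z"
  by (simp add: blind_above_def)

lemma blind_aboveD2: "blind_above u P \<Longrightarrow> u < z \<Longrightarrow> u < z' \<Longrightarrow> P z b = P z' b"
  unfolding blind_above_def by blast

lemma adj_count_large_prefix:
  assumes "blind_above u P" "T \<noteq> []" "\<forall>z\<in>set T. u < z" "u < z0"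
  shows "adj_count P (T @ Y) = adj_count P (z0 # Y)"
  using assms
proof (induction T rule: induct_list012)
  case (2 x)
  then have "P x = P z0" by (auto simp: fun_eq_iff dest: blind_aboveD2)
  then show ?case by (cases Y) simp_all
next
  case (3 x y zs)
  then have "\<not> P x y" by (auto dest: blind_aboveD1)
  with 3 show ?case by simp
qed auto

text \<open>
  The insertion of a value above \<open>u\<close> turns one run of letters above \<open>u\<close> into another such run, so
  this lemma is what makes the statistics of a value independent of later insertions.
\<close>
lemma adj_count_exchange:
  assumes "blind_above u P" "T \<noteq> []" "\<forall>z\<in>set T. u < z" "T' \<noteq> []" "\<forall>z\<in>set T'. u < z"
  shows "adj_count P (X @ T @ Y) = adj_count P (X @ T' @ Y)"
proof -
  have *: "adj_count P (X @ T @ Y) = adj_count P X + adj_count P (Suc u # Y)"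
    if T: "T \<noteq> []" "\<forall>z\<in>set T. u < z" for T
  proof -
    obtain z T1 where z: "T = z # T1" using T by (cases T) auto
    have "adj_count P (X @ z # (T1 @ Y)) = adj_count P X + adj_count P (z # (T1 @ Y))"
      by (rule adj_count_append) (use assms(1) T z in \<open>auto dest: blind_aboveD1\<close>)
    also have "adj_count P (z # (T1 @ Y)) = adj_count P (Suc u # Y)"
      using adj_count_large_prefix[OF assms(1) T, of "Suc u" Y] z by simp
    finally show ?thesis using z by simp
  qed
  show ?thesis using *[OF assms(2,3)] *[OF assms(4,5)] by simp
qed

definition straddle :: "nat \<Rightarrow> nat \<Rightarrow> nat \<Rightarrow> bool" where
  "straddle u a b \<longleftrightarrow> a > u \<and> u > b"

text \<open>
  The word analogues of \<open>l\<^sub>\<sigma>(u)\<close> and \<open>r\<^sub>\<sigma>(u)\<close>. The suffix used for the latter still starts with \<open>u\<close>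
  itself, which is harmless because \<open>straddle u\<close> never holds with \<open>u\<close> in first place.
\<close>
definition left :: "nat list \<Rightarrow> nat \<Rightarrow> nat" where
  "left W u = adj_count (straddle u) (takeWhile (\<lambda>x. x \<noteq> u) W)"

definition right :: "nat list \<Rightarrow> nat \<Rightarrow> nat" where
  "right W u = adj_count (straddle u) (dropWhile (\<lambda>x. x \<noteq> u) W)"

definition in_descent :: "nat list \<Rightarrow> nat \<Rightarrow> bool" where
  "in_descent W u \<longleftrightarrow> adj_count (\<lambda>a b. a > b \<and> (a = u \<or> b = u)) W > 0"

lemma blind_above_straddle: "blind_above u (straddle u)"
  by (auto simp: blind_above_def straddle_def)

lemma exchange_invariance:
  assumes T: "T \<noteq> []" "\<forall>z\<in>set T. u < z" "T' \<noteq> []" "\<forall>z\<in>set T'. u < z"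
  shows "left (X @ T @ Y) u = left (X @ T' @ Y) u"
    and "right (X @ T @ Y) u = right (X @ T' @ Y) u"
    and "in_descent (X @ T @ Y) u = in_descent (X @ T' @ Y) u"
proof -
  note exch = adj_count_exchange[OF blind_above_straddle T]
  have u: "\<forall>z\<in>set T. z \<noteq> u" "\<forall>z\<in>set T'. z \<noteq> u" using T by auto
  show "left (X @ T @ Y) u = left (X @ T' @ Y) u"
  proof (cases "u \<in> set X")
    case True
    then show ?thesis by (auto simp: left_def)
  next
    case False
    then have "\<forall>x\<in>set X. x \<noteq> u" by auto
    with u exch show ?thesis by (simp add: left_def)
  qed
  show "right (X @ T @ Y) u = right (X @ T' @ Y) u"
  proof (cases "u \<in> set X")
    case True
    then have "dropWhile (\<lambda>x. x \<noteq> u) (X @ Z) = dropWhile (\<lambda>x. x \<noteq> u) X @ Z" for Z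
      by (simp add: dropWhile_append) auto
    with exch show ?thesis by (simp add: right_def)
  next
    case False
    then have "\<forall>x\<in>set X. x \<noteq> u" by auto
    with u show ?thesis by (simp add: right_def)
  qed
  have "blind_above u (\<lambda>a b. a > b \<and> (a = u \<or> b = u))"
    by (auto simp: blind_above_def)
  from adj_count_exchange[OF this T]
  show "in_descent (X @ T @ Y) u = in_descent (X @ T' @ Y) u"
    by (simp add: in_descent_def)
qed

section \<open>Words built by inserting values in increasing order\<close>

text \<open>
  On distinct letters, this says that a descent must be even-odd. The place holder \<open>N\<close> will be an
  even number larger than all values: this makes a descent from \<open>N\<close> into an odd value admissible,
  as it should be since values still to come may be even, and rules out two adjacent place
  holders, since \<open>N\<close> may not precede itself.
\<close>
definition may_precede :: "nat \<Rightarrow> nat \<Rightarrow> bool" where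
  "may_precede a b \<longleftrightarrow> a < b \<or> even a \<and> odd b"

definition partial_words :: "nat \<Rightarrow> nat \<Rightarrow> nat list set" where
  "partial_words N v = {W. set W = insert N {1..v} \<and> distinct (filter (\<lambda>x. x \<noteq> N) W)
      \<and> last W = N \<and> successively may_precede W}"

text \<open>
  Insertion of \<open>x\<close> at the place holder between \<open>X\<close> and \<open>Y\<close>; the flag \<open>d\<close> says whether \<open>x\<close> takes part
  in a descent of the final permutation, which is thought of as preceded by \<open>0\<close> and followed by
  \<open>\<infinity>\<close>. If it does not, its neighbours are smaller on the left and larger on the right. If
  it is odd, it is a descent bottom and not a top, so both neighbours are larger. If it is even,
  it is a descent top and not a bottom, so both neighbours are smaller.
\<close>
definition insert_at :: "nat \<Rightarrow> bool \<Rightarrow> nat \<Rightarrow> nat list \<Rightarrow> nat list \<Rightarrow> nat list" where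
  "insert_at N d x X Y = X @ (if \<not> d then [x, N] else if odd x then [N, x, N] else [x]) @ Y"

lemma partial_words_0: "partial_words N 0 = {[N]}" if "even N"
proof -
  have "W = [N]" if W: "set W = {N}" "successively may_precede W" for W
  proof (cases W)
    case (Cons a W')
    moreover have "W' = []"
    proof (rule ccontr)
      assume "W' \<noteq> []"
      then have "hd W' \<in> set W" "a \<in> set W" "may_precede a (hd W')"
        using W(2) Cons by (simp_all add: successively_Cons)
      then show False using W(1) \<open>even N\<close> by (simp add: may_precede_def)
    qed
    ultimately show ?thesis using W by auto
  qed (use W in auto)
  then show ?thesis by (auto simp: partial_words_def)
qed

lemma partial_words_split:
  assumes "even N" "Suc v < N" "X @ N # Y \<in> partial_words N v"
  shows "set X \<subseteq> insert N {1..v}" "set Y \<subseteq> insert N {1..v}"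
    "successively may_precede X" "successively may_precede (N # Y)"
    "X \<noteq> [] \<Longrightarrow> last X < Suc v" "Y \<noteq> [] \<Longrightarrow> odd (hd Y) \<and> hd Y < Suc v" "last (N # Y) = N"
proof -
  from assms(3) have W: "insert N (set X \<union> set Y) = insert N {1..v}" "last (N # Y) = N"
      "successively may_precede X" "successively may_precede (N # Y)"
      "X \<noteq> [] \<Longrightarrow> may_precede (last X) N"
    by (auto simp: partial_words_def successively_append_iff)
  show XY: "set X \<subseteq> insert N {1..v}" "set Y \<subseteq> insert N {1..v}" using W(1) by auto
  show "successively may_precede X" "successively may_precede (N # Y)"
    "last (N # Y) = N"
    using W by auto
  show "last X < Suc v" if "X \<noteq> []"
  proof -
    have "last X \<in> insert N {1..v}" "last X < N"
      using W(5) XY assms(1) last_in_set[of X] that by (blast, simp add: may_precede_def)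
    then show ?thesis by auto
  qed
  show "odd (hd Y) \<and> hd Y < Suc v" if "Y \<noteq> []"
  proof -
    have "hd Y \<in> insert N {1..v}" "hd Y \<noteq> N"
      using W(4) XY assms(1) hd_in_set[of Y] that
      by (blast, auto simp add: may_precede_def successively_Cons)
    then have "hd Y \<le> v" by auto
    with W(4) that assms(2) show ?thesis by (simp add: may_precede_def successively_Cons)
  qed
qed

lemma insert_at_in_partial_words:
  assumes "even N" "Suc v < N" "X @ N # Y \<in> partial_words N v" "d \<Longrightarrow> even (Suc v) \<Longrightarrow> Y \<noteq> []"
  shows "insert_at N d (Suc v) X Y \<in> partial_words N (Suc v)"
proof -
  from assms(3) have W: "insert N (set X \<union> set Y) = insert N {1..v}"
      "distinct (filter (\<lambda>x. x \<noteq> N) (X @ Y))"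
    by (auto simp: partial_words_def)
  note XY = partial_words_split[OF assms(1-3)]
  have ends: "X = [] \<or> last X < Suc v" "Y = [] \<or> odd (hd Y) \<and> hd Y < Suc v"
    using XY(5,6) by blast+
  have new: "Suc v \<notin> set X" "Suc v \<notin> set Y" using XY(1,2) assms(2) by auto
  have set: "set (insert_at N d (Suc v) X Y) = insert N {1..Suc v}"
  proof -
    have "N \<in> set Y" if "Y \<noteq> []" using XY(7) last_in_set[of Y] that by auto
    then have "set (insert_at N d (Suc v) X Y) = insert (Suc v) (insert N (set X \<union> set Y))"
      using assms(4) by (auto simp: insert_at_def)
    then show ?thesis using W(1) by (simp add: atLeastAtMostSuc_conv insert_commute)
  qed
  have dist: "distinct (filter (\<lambda>x. x \<noteq> N) (insert_at N d (Suc v) X Y))"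
    using W(2) new assms(2) by (auto simp: insert_at_def)
  have last: "last (insert_at N d (Suc v) X Y) = N"
    using XY(7) assms(4) by (auto simp: insert_at_def)
  have "successively may_precede (insert_at N d (Suc v) X Y)"
    using XY(3,4) ends assms(1,2,4)
    by (auto simp: insert_at_def successively_append_iff successively_Cons may_precede_def)
  with set dist last show ?thesis by (simp add: partial_words_def)
qed

text \<open>
  Every word arises by an insertion: collapsing the largest value and the place holders next to it
  into a single place holder undoes it. The remaining possibility, that \<open>Suc v\<close> is preceded by a
  place holder and followed by a value, is excluded because \<open>Suc v\<close> would have to be both odd and
  even.
\<close>
lemma partial_words_SucE:
  assumes "even N" "Suc v < N" "W \<in> partial_words N (Suc v)"
  obtains d X Y where "X @ N # Y \<in> partial_words N v" "d \<and> even (Suc v) \<longrightarrow> Y \<noteq> []"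
    "W = insert_at N d (Suc v) X Y"
proof -
  from assms(3) have W: "set W = insert N {1..Suc v}" "distinct (filter (\<lambda>x. x \<noteq> N) W)"
      "last W = N" "successively may_precede W"
    by (auto simp: partial_words_def)
  have "Suc v \<in> set W" using W(1) by auto
  then obtain X Y where XY: "W = X @ Suc v # Y" by (auto simp: in_set_conv_decomp)
  have "Y \<noteq> []" using XY W(3) assms(2) by auto
  have new: "Suc v \<notin> set X" "Suc v \<notin> set Y" using W(2) XY assms(2) by auto
  have XYset: "insert N (set X \<union> set Y) = insert N {1..v}"
    using W(1) new assms(2) unfolding XY by (auto simp: atLeastAtMostSuc_conv)
  have NY: "N \<in> set Y" using W(3) XY \<open>Y \<noteq> []\<close> last_in_set[of Y] by auto
  have succ: "successively may_precede X" "successively may_precede Y" "may_precede (Suc v) (hd Y)"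
      "X \<noteq> [] \<Longrightarrow> may_precede (last X) (Suc v)"
    using W(4) XY \<open>Y \<noteq> []\<close> by (auto simp: successively_append_iff successively_Cons)
  have lY: "last Y = N" using W(3) XY \<open>Y \<noteq> []\<close> by auto
  have lX: "X \<noteq> [] \<Longrightarrow> last X \<noteq> N \<Longrightarrow> last X < N"
    using last_in_set[of X] XYset assms(2) by fastforce
  have dist: "distinct (filter (\<lambda>x. x \<noteq> N) (X @ Y))"
    using W(2) XY assms(2) by auto
  have obt: "\<exists>Y'. Y = N # Y'" if "hd Y = N" using that \<open>Y \<noteq> []\<close> by (cases Y) auto
  consider (plain) Y' where "Y = N # Y'" "X = [] \<or> last X \<noteq> N"
    | (bot) X' Y' where "Y = N # Y'" "X = X' @ [N]"
    | (top) "hd Y \<noteq> N"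
    using obt by (metis append_butlast_last_id)
  then show thesis
  proof cases
    case plain
    have "X @ N # Y' \<in> partial_words N v"
      using XYset dist lY succ lX plain
      by (auto simp: partial_words_def successively_append_iff may_precede_def)
    then show ?thesis using XY plain by (intro that[of X Y' False]) (auto simp: insert_at_def)
  next
    case bot
    have "odd (Suc v)" using succ(4) bot assms(2) by (auto simp: may_precede_def)
    have "last X' < N" if "X' \<noteq> []"
      using succ(1) bot that assms(1) by (auto simp: successively_append_iff may_precede_def)
    then have "X' @ N # Y' \<in> partial_words N v"
      using XYset dist lY succ bot
      by (auto simp: partial_words_def successively_append_iff may_precede_def)
    then show ?thesis using XY bot \<open>odd (Suc v)\<close>
      by (intro that[of X' Y' True]) (auto simp: insert_at_def)
  next
    case top
    have "hd Y \<in> {1..v}" using top hd_in_set[OF \<open>Y \<noteq> []\<close>] XYset by auto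
    then have par: "even (Suc v)" "odd (hd Y)" using succ(3) by (auto simp: may_precede_def)
    have "X \<noteq> [] \<Longrightarrow> last X < N"
      using succ(4) par(1) assms(2) by (auto simp: may_precede_def)
    then have "X @ N # Y \<in> partial_words N v"
      using XYset dist lY succ par assms(1) NY \<open>Y \<noteq> []\<close>
      by (auto simp: partial_words_def successively_append_iff successively_Cons may_precede_def)
    then show ?thesis using XY par \<open>Y \<noteq> []\<close>
      by (intro that[of X Y True]) (auto simp: insert_at_def)
  qed
qed

section \<open>The statistics of an inserted value\<close>

lemma adj_count_eq_0_iff: "adj_count P W = 0 \<longleftrightarrow> successively (\<lambda>a b. \<not> P a b) W"
  by (induction W rule: induct_list012) auto

lemma in_descent_iff:
  "in_descent W u \<longleftrightarrow> \<not> successively (\<lambda>a b. \<not> (a > b \<and> (a = u \<or> b = u))) W"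
  unfolding in_descent_def neq0_conv[symmetric] adj_count_eq_0_iff ..

lemma in_descent_imp_mem: "in_descent W u \<Longrightarrow> u \<in> set W"
  unfolding in_descent_iff by (induction W rule: induct_list012) auto

lemma insert_at_old_data:
  assumes "u \<le> v" "v < N"
  shows "left (insert_at N d (Suc v) X Y) u = left (X @ N # Y) u"
    and "right (insert_at N d (Suc v) X Y) u = right (X @ N # Y) u"
    and "in_descent (insert_at N d (Suc v) X Y) u = in_descent (X @ N # Y) u"
  using exchange_invariance[of "if \<not> d then [Suc v, N] else if odd (Suc v) then [N, Suc v, N] else [Suc v]"
      u "[N]" X Y] assms
  by (auto simp: insert_at_def)

text \<open>
  As long as only place holders exceed \<open>v\<close>, the descents straddling \<open>Suc v\<close> are those from a place
  holder to its right neighbour; only a place holder at the very end has none.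
\<close>
lemma straddle_count_eq_count_list:
  assumes "even N" "Suc v < N" "set Z \<subseteq> insert N {1..v}" "successively may_precede Z" "Z \<noteq> []"
  shows "adj_count (straddle (Suc v)) Z + (if last Z = N then 1 else 0) = count_list Z N"
  using assms(3-5)
proof (induction Z rule: induct_list012)
  case (3 a b Z)
  from 3(4) assms(1) have ne: "\<not> (a = N \<and> b = N)" by (auto simp: may_precede_def)
  moreover have "a = N \<or> a \<le> v" "b = N \<or> b \<le> v" using 3(3) by auto
  ultimately have "straddle (Suc v) a b \<longleftrightarrow> a = N"
    using assms(2) by (auto simp: straddle_def)
  with 3 show ?case by simp
qed auto

lemma insert_at_new_data:
  assumes "even N" "Suc v < N" "X @ N # Y \<in> partial_words N v" "d \<and> even (Suc v) \<longrightarrow> Y \<noteq> []"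
  defines "W \<equiv> insert_at N d (Suc v) X Y"
  shows "left W (Suc v) = count_list X N"
    and "right W (Suc v) + (if d \<and> even (Suc v) then 1 else 0) = count_list Y N"
    and "in_descent W (Suc v) = d"
    and "count_list W N = count_list X N + count_list Y N
           + (if \<not> d then 1 else if odd (Suc v) then 2 else 0)"
proof -
  note XY = partial_words_split[OF assms(1-3)]
  have new: "Suc v \<notin> set X" "Suc v \<notin> set Y" using XY(1,2) assms(2) by auto
  then have newX: "\<forall>x\<in>set X. x \<noteq> Suc v" by auto
  have X: "adj_count (straddle (Suc v)) X = count_list X N"
    using straddle_count_eq_count_list[OF assms(1,2) XY(1,3)] XY(5) assms(2)
    by (cases "X = []") auto
  have NY: "adj_count (straddle (Suc v)) (N # Y) = count_list Y N"
    using straddle_count_eq_count_list[OF assms(1,2) _ XY(4)] XY(2,7) by auto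
  have Y: "adj_count (straddle (Suc v)) Y + 1 = count_list Y N" if "Y \<noteq> []"
    using straddle_count_eq_count_list[OF assms(1,2) XY(2)] XY(4,7) that
    by (auto simp: successively_Cons)
  have XN: "adj_count (straddle (Suc v)) (X @ [N]) = adj_count (straddle (Suc v)) X"
    using adj_count_append[of "straddle (Suc v)" N X "[]"] assms(2) by (auto simp: straddle_def)
  have x: "adj_count (straddle (Suc v)) (Suc v # Z) = adj_count (straddle (Suc v)) Z" for Z
    by (rule adj_count_Cons) (auto simp: straddle_def)
  show "left W (Suc v) = count_list X N"
    using X XN newX assms(2) by (auto simp: left_def W_def insert_at_def)
  show "right W (Suc v) + (if d \<and> even (Suc v) then 1 else 0) = count_list Y N"
  proof -
    have "\<not> straddle (Suc v) (Suc v) N" by (simp add: straddle_def)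
    then show ?thesis
      using NY Y x newX assms(2,4) by (auto simp: right_def W_def insert_at_def)
  qed
  have mem: "successively (\<lambda>a b. \<not> (b < a \<and> (a = Suc v \<or> b = Suc v))) Z" if "Suc v \<notin> set Z" for Z
    using that in_descent_imp_mem[of Z "Suc v"] by (auto simp: in_descent_iff)
  show "in_descent W (Suc v) = d"
  proof (cases d)
    case True
    with assms(2,4) XY(6) show ?thesis
      by (auto simp: in_descent_iff W_def insert_at_def successively_append_iff successively_Cons)
  next
    case False
    with assms(2) XY(5,6) mem[OF new(1)] mem[OF new(2)] show ?thesis
      by (auto simp: in_descent_iff W_def insert_at_def successively_append_iff successively_Cons)
  qed
  show "count_list W N = count_list X N + count_list Y N
           + (if \<not> d then 1 else if odd (Suc v) then 2 else 0)"
    using assms(2) by (auto simp: W_def insert_at_def)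
qed

section \<open>Prescribing descent sets and left statistics\<close>

definition excess :: "nat set \<Rightarrow> nat \<Rightarrow> int" where
  "excess S x = int (card {y \<in> S. odd y \<and> y < x}) - int (card {y \<in> S. even y \<and> y < x})"

text \<open>
  This is the number \<open>s(x)\<close> of the normalization condition, with an arbitrary set \<open>S\<close> in place of
  \<open>S\<^sub>\<sigma>\<close>. Its meaning is the number of positions at which \<open>x\<close> can be inserted.
\<close>
definition slots :: "nat set \<Rightarrow> nat \<Rightarrow> int" where
  "slots S x = excess S x + (if x \<in> S \<and> even x then 0 else 1)"

lemma excess_Suc:
  "excess S (Suc x) = excess S x + (if x \<in> S then if odd x then 1 else -1 else 0)"
proof -
  have *: "{y \<in> S. Q y \<and> y < Suc x}
      = (if x \<in> S \<and> Q x then insert x else id) {y \<in> S. Q y \<and> y < x}" for Q :: "nat \<Rightarrow> bool"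
    by (auto simp: less_Suc_eq)
  show ?thesis unfolding excess_def *[of odd] *[of even] by auto
qed

lemma excess_1: "0 \<notin> S \<Longrightarrow> excess S (Suc 0) = 0"
  by (auto simp: excess_Suc) (simp add: excess_def)

text \<open>
  The excess is the number of descents that have been opened by an inserted bottom but whose top
  is still missing; each of them needs a place holder, besides the closing one.
\<close>
lemma partial_word_slots:
  assumes "0 \<notin> S" "even N" "v < N" "W \<in> partial_words N v"
    "\<forall>u\<in>{1..v}. in_descent W u \<longleftrightarrow> u \<in> S"
  shows "int (count_list W N) = 1 + excess S (Suc v)
    \<and> (\<forall>u\<in>{1..v}. int (left W u) + int (right W u) + 1 = slots S u)"
  using assms(3-5)
proof (induction v arbitrary: W)
  case 0
  then show ?case using excess_1[OF assms(1)] partial_words_0[OF assms(2)] by auto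
next
  case (Suc v)
  from partial_words_SucE[OF assms(2) Suc.prems(1,2)] obtain d X Y where
    U: "X @ N # Y \<in> partial_words N v" "d \<and> even (Suc v) \<longrightarrow> Y \<noteq> []"
      and W: "W = insert_at N d (Suc v) X Y" by metis
  note new = insert_at_new_data[OF assms(2) Suc.prems(1) U]
  have old: "left W u = left (X @ N # Y) u" "right W u = right (X @ N # Y) u"
    "in_descent W u = in_descent (X @ N # Y) u" if "u \<le> v" for u
    using insert_at_old_data[OF that, of N] Suc.prems(1) W by auto
  have P: "\<forall>u\<in>{1..v}. in_descent (X @ N # Y) u \<longleftrightarrow> u \<in> S"
    using Suc.prems(3) by (auto simp: old(3)[symmetric])
  have IH: "int (count_list (X @ N # Y) N) = 1 + excess S (Suc v)"
    "\<forall>u\<in>{1..v}. int (left (X @ N # Y) u) + int (right (X @ N # Y) u) + 1 = slots S u"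
    using Suc.IH[OF _ U(1) P] Suc.prems(1) by simp_all
  have d: "d \<longleftrightarrow> Suc v \<in> S" using Suc.prems(3) new(3) W by auto
  have "int (count_list W N) = 1 + excess S (Suc (Suc v))"
    using IH(1) new(4) W d by (auto simp: excess_Suc[of S "Suc v"] split: if_splits)
  moreover have "int (left W (Suc v)) + int (right W (Suc v)) + 1 = slots S (Suc v)"
    using IH(1) new(1,2) W d by (auto simp: slots_def split: if_splits)
  ultimately show ?case using IH(2) old by (auto simp: le_Suc_eq)
qed

lemma count_list_split:
  assumes "l < count_list W N"
  shows "\<exists>X Y. W = X @ N # Y \<and> count_list X N = l"
  using assms
proof (induction W arbitrary: l)
  case (Cons a W)
  show ?case
  proof (cases "a = N \<and> l = 0")
    case True
    then show ?thesis by (intro exI[of _ "[]"] exI[of _ W]) auto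
  next
    case False
    then have "(if a = N then l - 1 else l) < count_list W N" using Cons.prems by auto
    from Cons.IH[OF this] obtain X Y where
      "W = X @ N # Y" "count_list X N = (if a = N then l - 1 else l)" by auto
    with False show ?thesis by (intro exI[of _ "a # X"] exI[of _ Y]) auto
  qed
qed simp

lemma count_list_split_unique:
  assumes "X @ N # Y = X' @ N # Y'" "count_list X N = count_list X' N"
  shows "X = X' \<and> Y = Y'"
  using assms
proof (induction X arbitrary: X')
  case Nil
  then show ?case by (cases X') auto
next
  case (Cons a X)
  then show ?case by (cases X') (auto split: if_splits)
qed

text \<open>
  The central step: membership in \<open>S\<close> fixes the kind of each insertion, and \<open>l u\<close> fixes its
  position, since it is the number of place holders to its left. The bound on \<open>l u\<close> guarantees
  that this position exists, and that a value consuming a place holder does not consume the last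
  one.
\<close>
lemma partial_word_unique_existence:
  assumes "0 \<notin> S" "even N" "v < N" "\<forall>u\<in>{1..v}. int (l u) < slots S u"
  shows "\<exists>!W. W \<in> partial_words N v \<and> (\<forall>u\<in>{1..v}. (in_descent W u \<longleftrightarrow> u \<in> S) \<and> left W u = l u)"
  using assms(3,4)
proof (induction v)
  case 0
  then show ?case using partial_words_0[OF assms(2)] by auto
next
  case (Suc v)
  let ?x = "Suc v" and ?P = "\<lambda>W v. \<forall>u\<in>{1..v}. (in_descent W u \<longleftrightarrow> u \<in> S) \<and> left W u = l u"
  have "\<exists>!W. W \<in> partial_words N v \<and> ?P W v"
    by (rule Suc.IH) (use Suc.prems in auto)
  then obtain U where U: "U \<in> partial_words N v \<and> ?P U v"
    and uniq: "\<forall>U'. U' \<in> partial_words N v \<and> ?P U' v \<longrightarrow> U' = U"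
    by (rule ex1E)
  note U = conjunct1[OF U] conjunct2[OF U]
  have count: "int (count_list U N) = 1 + excess S ?x"
    using partial_word_slots[OF assms(1,2) _ U(1)] U(2) Suc.prems(1) by simp
  have lx: "int (l ?x) < slots S ?x" using Suc.prems(2) by simp
  then have "l ?x < count_list U N" using count by (auto simp: slots_def split: if_splits)
  then obtain X Y where XY: "U = X @ N # Y" "count_list X N = l ?x"
    using count_list_split[of "l ?x" U N] by metis
  have Y: "?x \<in> S \<and> even ?x \<longrightarrow> Y \<noteq> []"
  proof (intro impI notI)
    assume "?x \<in> S \<and> even ?x" "Y = []"
    then show False using lx count XY by (simp add: slots_def)
  qed
  let ?W = "insert_at N (?x \<in> S) ?x X Y"
  show ?case
  proof (rule ex1I[of _ ?W])
    have "?W \<in> partial_words N ?x"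
      using insert_at_in_partial_words[OF assms(2) Suc.prems(1)] U(1) XY(1) Y by blast
    moreover have "(in_descent ?W u \<longleftrightarrow> u \<in> S) \<and> left ?W u = l u" if "u \<in> {1..?x}" for u
    proof (cases "u = ?x")
      case True
      then show ?thesis
        using insert_at_new_data[OF assms(2) Suc.prems(1), of X Y "?x \<in> S"] U(1) XY Y by simp
    next
      case False
      then have "u \<in> {1..v}" using that by auto
      then show ?thesis
        using insert_at_old_data[of u v N "?x \<in> S" X Y] U(2) XY(1) Suc.prems(1) by simp
    qed
    ultimately show "?W \<in> partial_words N ?x \<and> ?P ?W ?x" by blast
  next
    fix W' assume W': "W' \<in> partial_words N ?x \<and> ?P W' ?x"
    from partial_words_SucE[OF assms(2) Suc.prems(1), of W'] W' obtain d X' Y' where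
      U': "X' @ N # Y' \<in> partial_words N v" "d \<and> even ?x \<longrightarrow> Y' \<noteq> []"
        and eq: "W' = insert_at N d ?x X' Y'" by metis
    note new = insert_at_new_data[OF assms(2) Suc.prems(1) U']
    have "(in_descent (X' @ N # Y') u \<longleftrightarrow> u \<in> S) \<and> left (X' @ N # Y') u = l u"
      if "u \<in> {1..v}" for u
      using insert_at_old_data[of u v N d X' Y'] W' eq Suc.prems(1) that by simp
    then have "X' @ N # Y' = X @ N # Y" using uniq U'(1) XY(1) by blast
    moreover have "count_list X' N = count_list X N" "d \<longleftrightarrow> ?x \<in> S"
    proof -
      have "in_descent W' ?x \<longleftrightarrow> ?x \<in> S" "left W' ?x = l ?x" using W' by simp_all
      then show "count_list X' N = count_list X N" "d \<longleftrightarrow> ?x \<in> S"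
        using new(1,3) XY(2) unfolding eq by simp_all
    qed
    ultimately show "W' = ?W" using count_list_split_unique[of X' N Y' X Y] eq by simp
  qed
qed

lemma adj_count_map_upt:
  "adj_count P (map f [a..<b]) = card {i. a \<le> i \<and> Suc i < b \<and> P (f i) (f (Suc i))}"
proof -
  have "{i. a \<le> i \<and> Suc i < b \<and> P (f i) (f (Suc i))}
      = (\<lambda>i. i + a) ` {i. Suc i < b - a \<and> P (f (a + i)) (f (Suc (a + i)))}" (is "?L = _ ` ?R")
  proof (intro equalityI subsetI)
    fix i assume "i \<in> ?L"
    then show "i \<in> (\<lambda>i. i + a) ` ?R" by (intro image_eqI[of _ _ "i - a"]) auto
  qed (auto simp: ac_simps)
  then have "card ?L = card ?R" by (simp add: card_image)
  moreover have "adj_count P (map f [a..<b]) = card ?R"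
    unfolding adj_count_card by (rule arg_cong[of _ _ card]) auto
  ultimately show ?thesis by simp
qed

section \<open>Permutations as completed words\<close>

text \<open>
  Once all values are inserted, a permutation is followed by the single remaining place holder,
  for which the even number \<open>2 * n + 2\<close> is taken (\<open>2 * n + 1\<close> would be odd).
\<close>
definition closed_word :: "nat \<Rightarrow> (nat \<Rightarrow> nat) \<Rightarrow> nat list" where
  "closed_word n \<sigma> = map \<sigma> [1..<Suc (2 * n)] @ [2 * n + 2]"

lemma closed_word_split:
  assumes "\<sigma> permutes {1..2 * n}" "u \<in> {1..2 * n}"
  shows "closed_word n \<sigma> = map \<sigma> [1..<inv \<sigma> u] @ u # map \<sigma> [Suc (inv \<sigma> u)..<Suc (2 * n)] @ [2 * n + 2]"
    "u \<notin> set (map \<sigma> [1..<inv \<sigma> u])" "inv \<sigma> u \<in> {1..2 * n}"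
proof -
  let ?j = "inv \<sigma> u"
  show j: "?j \<in> {1..2 * n}"
    using assms(2) permutes_in_image[OF permutes_inv[OF assms(1)], of u] by blast
  have sj: "\<sigma> ?j = u" using permutes_inverses(1)[OF assms(1)] .
  have "[1..<Suc (2 * n)] = [1..<?j] @ ?j # [Suc ?j..<Suc (2 * n)]"
    using j upt_add_eq_append[of 1 ?j "Suc (2 * n) - ?j"] upt_conv_Cons[of ?j "Suc (2 * n)"]
    by (simp del: upt_Suc)
  then show "closed_word n \<sigma> = map \<sigma> [1..<?j] @ u # map \<sigma> [Suc ?j..<Suc (2 * n)] @ [2 * n + 2]"
    unfolding closed_word_def using sj by (simp del: upt_Suc)
  have "\<sigma> i \<noteq> u" if "i < ?j" for i
    using sj that permutes_inverses(2)[OF assms(1), of i] by auto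
  then show "u \<notin> set (map \<sigma> [1..<?j])" by (metis atLeastLessThan_iff image_iff list.set_map set_upt)
qed

lemma left_closed_word:
  assumes "\<sigma> permutes {1..2 * n}" "u \<in> {1..2 * n}"
  shows "left (closed_word n \<sigma>) u = lstat \<sigma> u"
proof -
  note split = closed_word_split[OF assms]
  have "takeWhile (\<lambda>x. x \<noteq> u) (closed_word n \<sigma>) = map \<sigma> [1..<inv \<sigma> u]"
    unfolding split(1) by (subst takeWhile_append2) (use split(2) in \<open>auto simp del: upt_Suc\<close>)
  then have "left (closed_word n \<sigma>) u
      = card {i. 1 \<le> i \<and> Suc i < inv \<sigma> u \<and> straddle u (\<sigma> i) (\<sigma> (Suc i))}"
    by (simp add: left_def adj_count_map_upt)
  also have "\<dots> = card (Suc ` {i. 1 \<le> i \<and> Suc i < inv \<sigma> u \<and> straddle u (\<sigma> i) (\<sigma> (Suc i))})"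
    by (simp add: card_image)
  also have "Suc ` {i. 1 \<le> i \<and> Suc i < inv \<sigma> u \<and> straddle u (\<sigma> i) (\<sigma> (Suc i))}
      = {i. 2 \<le> i \<and> i < inv \<sigma> u \<and> \<sigma> (i - 1) > u \<and> u > \<sigma> i}" (is "?L = ?R")
  proof (intro equalityI subsetI)
    fix i assume "i \<in> ?R"
    then show "i \<in> ?L" by (intro image_eqI[of _ _ "i - 1"]) (auto simp: straddle_def)
  qed (auto simp: straddle_def)
  finally show ?thesis by (simp add: lstat_def)
qed

lemma right_closed_word:
  assumes "\<sigma> permutes {1..2 * n}" "u \<in> {1..2 * n}"
  shows "right (closed_word n \<sigma>) u = rstat (2 * n) \<sigma> u"
proof -
  note split = closed_word_split[OF assms]
  have "dropWhile (\<lambda>x. x \<noteq> u) (closed_word n \<sigma>)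
      = u # map \<sigma> [Suc (inv \<sigma> u)..<Suc (2 * n)] @ [2 * n + 2]"
    unfolding split(1) by (subst dropWhile_append2) (use split(2) in \<open>auto simp del: upt_Suc\<close>)
  moreover have "adj_count (straddle u) (u # Z) = adj_count (straddle u) Z" for Z
    by (rule adj_count_Cons) (simp add: straddle_def)
  moreover have "adj_count (straddle u) (Z @ [2 * n + 2]) = adj_count (straddle u) Z" for Z
    using adj_count_append[of "straddle u" "2 * n + 2" Z "[]"] assms(2) by (simp add: straddle_def)
  ultimately have "right (closed_word n \<sigma>) u
      = card {i. Suc (inv \<sigma> u) \<le> i \<and> Suc i < Suc (2 * n) \<and> straddle u (\<sigma> i) (\<sigma> (Suc i))}"
    by (simp add: right_def adj_count_map_upt del: upt_Suc)
  also have "\<dots> = rstat (2 * n) \<sigma> u"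
    unfolding rstat_def by (rule arg_cong[of _ _ card]) (auto simp: straddle_def)
  finally show ?thesis .
qed

lemma in_descent_closed_word:
  assumes "u \<in> {1..2 * n}"
  shows "in_descent (closed_word n \<sigma>) u \<longleftrightarrow> u \<in> S_set n \<sigma>"
proof -
  let ?P = "\<lambda>a b. a > b \<and> (a = u \<or> b = u)"
  let ?I = "{i. 1 \<le> i \<and> Suc i < Suc (2 * n) \<and> ?P (\<sigma> i) (\<sigma> (Suc i))}"
  have "adj_count ?P (closed_word n \<sigma>) = adj_count ?P (map \<sigma> [1..<Suc (2 * n)])"
    using adj_count_append[of ?P "2 * n + 2" "map \<sigma> [1..<Suc (2 * n)]" "[]"] assms
    by (simp add: closed_word_def del: upt_Suc)
  then have "in_descent (closed_word n \<sigma>) u \<longleftrightarrow> card ?I > 0"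
    unfolding in_descent_def adj_count_map_upt by simp
  also have "\<dots> \<longleftrightarrow> ?I \<noteq> {}"
    by (subst card_gt_0_iff) (auto intro: finite_subset[of _ "{..2 * n}"])
  also have "\<dots> \<longleftrightarrow> u \<in> S_set n \<sigma>"
    unfolding S_set_def tops_def bottoms_def descents_def image_def by fastforce
  finally show ?thesis .
qed

lemma X_perms_iff_closed_word:
  assumes "\<sigma> permutes {1..2 * n}"
  shows "\<sigma> \<in> X_perms n \<longleftrightarrow> closed_word n \<sigma> \<in> partial_words (2 * n + 2) (2 * n)"
proof -
  let ?N = "2 * n + 2" and ?w = "map \<sigma> [1..<Suc (2 * n)]"
  let ?P = "\<lambda>a b. \<not> may_precede a b"
  have im: "\<sigma> ` {1..2 * n} = {1..2 * n}" using permutes_image[OF assms] .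
  have set: "set ?w = {1..2 * n}"
    using im by (simp add: atLeastLessThanSuc_atLeastAtMost del: upt_Suc)
  have dist: "distinct ?w"
    using permutes_inj_on[OF assms] by (simp add: distinct_map del: upt_Suc)
  have filter: "filter (\<lambda>x. x \<noteq> ?N) (closed_word n \<sigma>) = ?w"
    unfolding closed_word_def using set by (auto simp: filter_id_conv simp del: upt_Suc)
  have last: "?w \<noteq> [] \<Longrightarrow> may_precede (last ?w) ?N"
    using last_in_set[of ?w] set by (auto simp: may_precede_def simp del: upt_Suc)
  have "closed_word n \<sigma> \<in> partial_words ?N (2 * n)
      \<longleftrightarrow> successively may_precede (closed_word n \<sigma>)"
    unfolding partial_words_def filter using set dist
    by (auto simp: closed_word_def simp del: upt_Suc)
  also have "\<dots> \<longleftrightarrow> successively may_precede ?w"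
    using last by (cases "n = 0") (simp_all add: closed_word_def successively_append_iff del: upt_Suc)
  also have "\<dots> \<longleftrightarrow> adj_count ?P ?w = 0"
    unfolding adj_count_eq_0_iff by simp
  also have "\<dots> \<longleftrightarrow> {i. 1 \<le> i \<and> Suc i < Suc (2 * n) \<and> ?P (\<sigma> i) (\<sigma> (Suc i))} = {}"
    unfolding adj_count_map_upt by (subst card_eq_0_iff) (auto intro: finite_subset[of _ "{..2 * n}"])
  also have "\<dots> \<longleftrightarrow> \<sigma> \<in> X_perms n"
  proof -
    have ne: "\<not> may_precede x y \<longleftrightarrow> x > y \<and> \<not> (even x \<and> odd y)" if "x \<noteq> y" for x y
      using that by (auto simp: may_precede_def)
    have "?P (\<sigma> i) (\<sigma> (Suc i)) \<longleftrightarrow> \<sigma> i > \<sigma> (Suc i) \<and> \<not> (even (\<sigma> i) \<and> odd (\<sigma> (Suc i)))" for i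
      by (rule ne) (simp add: inj_eq[OF permutes_inj[OF assms]])
    then show ?thesis using assms unfolding X_perms_def descents_def by auto
  qed
  finally show ?thesis by blast
qed

lemma closed_word_inj:
  assumes "\<sigma> permutes {1..2 * n}" "\<tau> permutes {1..2 * n}" "closed_word n \<sigma> = closed_word n \<tau>"
  shows "\<sigma> = \<tau>"
proof
  fix i
  have "\<forall>i\<in>{1..2 * n}. \<sigma> i = \<tau> i" using assms(3) by (auto simp: closed_word_def simp del: upt_Suc)
  then show "\<sigma> i = \<tau> i"
    using permutes_not_in[OF assms(1), of i] permutes_not_in[OF assms(2), of i] by (cases "i \<in> {1..2 * n}") auto
qed

lemma closed_word_surj:
  assumes "W \<in> partial_words (2 * n + 2) (2 * n)" "count_list W (2 * n + 2) = 1"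
  shows "\<exists>\<sigma>. \<sigma> permutes {1..2 * n} \<and> closed_word n \<sigma> = W"
proof -
  let ?N = "2 * n + 2"
  from assms(1) have W: "set W = insert ?N {1..2 * n}" "distinct (filter (\<lambda>x. x \<noteq> ?N) W)" "last W = ?N"
    by (auto simp: partial_words_def)
  then obtain ws where ws: "W = ws @ [?N]" by (metis append_butlast_last_id empty_set insert_not_empty)
  then have N: "?N \<notin> set ws" using assms(2) by (simp add: count_list_0_iff)
  have set: "set ws = {1..2 * n}"
  proof -
    have "set ws = set W - {?N}" using ws N by auto
    then show ?thesis using W(1) by auto
  qed
  have dist: "distinct ws"
  proof -
    have "filter (\<lambda>x. x \<noteq> ?N) ws = ws" using N by (auto simp: filter_id_conv)
    then show ?thesis using W(2) ws by simp
  qed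
  have len: "length ws = 2 * n" using distinct_card[OF dist] set by simp
  define \<sigma> where "\<sigma> i = (if i \<in> {1..2 * n} then ws ! (i - 1) else i)" for i
  have "bij_betw (\<lambda>i. i - 1) {1..2 * n} {..<length ws}"
    by (rule bij_betw_byWitness[of _ Suc]) (auto simp: len)
  from bij_betw_trans[OF this bij_betw_nth[OF dist refl refl]]
  have "bij_betw (\<lambda>i. ws ! (i - 1)) {1..2 * n} {1..2 * n}" by (simp add: o_def set)
  then have "bij_betw \<sigma> {1..2 * n} {1..2 * n}"
    by (rule iffD1[OF bij_betw_cong, rotated]) (simp add: \<sigma>_def)
  then have "\<sigma> permutes {1..2 * n}" by (rule bij_imp_permutes) (auto simp: \<sigma>_def)
  moreover have "map \<sigma> [1..<Suc (2 * n)] = ws"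
    by (rule nth_equalityI) (auto simp: len \<sigma>_def nth_append simp del: upt_Suc)
  then have "closed_word n \<sigma> = W" by (simp add: closed_word_def ws del: upt_Suc)
  ultimately show ?thesis by blast
qed

section \<open>The generating function of a fixed descent set\<close>

text \<open>
  Every descent has an even top and an odd bottom, so \<open>S\<^sub>\<sigma>\<close> has as many odd as even elements. Sets
  on which \<open>s\<close> takes a value below \<open>1\<close> belong to no permutation, and the product of sums in
  \<open>sum_fibre\<close> vanishes for them.
\<close>
definition balanced :: "nat \<Rightarrow> nat set set" where
  "balanced n = {S. S \<subseteq> {1..2 * n} \<and> excess S (Suc (2 * n)) = 0}"

lemma S_set_subset:
  assumes "\<sigma> permutes {1..2 * n}"
  shows "S_set n \<sigma> \<subseteq> {1..2 * n}"
proof -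
  have "S_set n \<sigma> \<subseteq> \<sigma> ` {1..2 * n}"
    unfolding S_set_def tops_def bottoms_def descents_def by force
  then show ?thesis using permutes_image[OF assms] by simp
qed

lemma X_perms_permutes: "\<sigma> \<in> X_perms n \<Longrightarrow> \<sigma> permutes {1..2 * n}"
  by (simp add: X_perms_def)

lemma X_perms_slots:
  assumes "\<sigma> \<in> X_perms n"
  shows "S_set n \<sigma> \<in> balanced n"
    and "u \<in> {1..2 * n} \<Longrightarrow>
      int (lstat \<sigma> u) + int (rstat (2 * n) \<sigma> u) + 1 = slots (S_set n \<sigma>) u"
proof -
  note perm = X_perms_permutes[OF assms]
  have "closed_word n \<sigma> \<in> partial_words (2 * n + 2) (2 * n)"
    using assms X_perms_iff_closed_word[OF perm] by simp
  moreover have "0 \<notin> S_set n \<sigma>" using S_set_subset[OF perm] by auto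
  ultimately
  have *: "int (count_list (closed_word n \<sigma>) (2 * n + 2)) = 1 + excess (S_set n \<sigma>) (Suc (2 * n))"
    "\<forall>u\<in>{1..2 * n}. int (left (closed_word n \<sigma>) u) + int (right (closed_word n \<sigma>) u) + 1
      = slots (S_set n \<sigma>) u"
    using partial_word_slots[of "S_set n \<sigma>" "2 * n + 2" "2 * n" "closed_word n \<sigma>"]
      in_descent_closed_word[of _ n \<sigma>] by simp_all
  have "2 * n + 2 \<notin> set (map \<sigma> [1..<Suc (2 * n)])"
    using permutes_image[OF perm]
    by (simp add: atLeastLessThanSuc_atLeastAtMost del: upt_Suc)
  then have "count_list (closed_word n \<sigma>) (2 * n + 2) = 1"
    by (simp add: closed_word_def count_list_0_iff del: upt_Suc)
  then show "S_set n \<sigma> \<in> balanced n"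
    using *(1) S_set_subset[OF perm] by (simp add: balanced_def)
  show "int (lstat \<sigma> u) + int (rstat (2 * n) \<sigma> u) + 1 = slots (S_set n \<sigma>) u"
    if "u \<in> {1..2 * n}"
    using bspec[OF *(2) that] left_closed_word[OF perm that] right_closed_word[OF perm that] by simp
qed

definition fibre :: "nat \<Rightarrow> nat set \<Rightarrow> (nat \<Rightarrow> nat) set" where
  "fibre n S = {\<sigma> \<in> X_perms n. S_set n \<sigma> = S}"

text \<open>
  Both injectivity and surjectivity are instances of the unique existence of a word with prescribed
  data; balancedness of \<open>S\<close> ensures that the final word has only one place holder left.
\<close>
lemma lstat_bij_betw_fibre:
  assumes "S \<in> balanced n"
  shows "bij_betw (\<lambda>\<sigma>. restrict (lstat \<sigma>) {1..2 * n}) (fibre n S)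
           (\<Pi>\<^sub>E v\<in>{1..2 * n}. {..<nat (slots S v)})"
proof (rule bij_betw_imageI)
  let ?N = "2 * n + 2"
  have S: "0 \<notin> S" "S \<subseteq> {1..2 * n}" "excess S (Suc (2 * n)) = 0"
    using assms by (auto simp: balanced_def)
  have word: "closed_word n \<sigma> \<in> partial_words ?N (2 * n)" "\<sigma> permutes {1..2 * n}"
    "\<forall>u\<in>{1..2 * n}. (in_descent (closed_word n \<sigma>) u \<longleftrightarrow> u \<in> S) \<and> left (closed_word n \<sigma>) u = lstat \<sigma> u"
    "\<forall>u\<in>{1..2 * n}. int (lstat \<sigma> u) < slots S u"
    if "\<sigma> \<in> fibre n S" for \<sigma>
  proof -
    have X: "\<sigma> \<in> X_perms n" "S_set n \<sigma> = S" using that by (auto simp: fibre_def)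
    show perm: "\<sigma> permutes {1..2 * n}" using X_perms_permutes[OF X(1)] .
    show "closed_word n \<sigma> \<in> partial_words ?N (2 * n)"
      using X X_perms_iff_closed_word[OF perm] by simp
    show "\<forall>u\<in>{1..2 * n}. (in_descent (closed_word n \<sigma>) u \<longleftrightarrow> u \<in> S)
        \<and> left (closed_word n \<sigma>) u = lstat \<sigma> u"
      using in_descent_closed_word[of _ n \<sigma>] left_closed_word[OF perm] X(2) by simp
    show "\<forall>u\<in>{1..2 * n}. int (lstat \<sigma> u) < slots S u"
    proof
      fix u assume "u \<in> {1..2 * n}"
      from X_perms_slots(2)[OF X(1) this] X(2) show "int (lstat \<sigma> u) < slots S u" by simp
    qed
  qed
  show "inj_on (\<lambda>\<sigma>. restrict (lstat \<sigma>) {1..2 * n}) (fibre n S)"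
  proof (rule inj_onI)
    fix \<sigma> \<tau> assume \<sigma>: "\<sigma> \<in> fibre n S" and \<tau>: "\<tau> \<in> fibre n S"
      and eq: "restrict (lstat \<sigma>) {1..2 * n} = restrict (lstat \<tau>) {1..2 * n}"
    have "lstat \<sigma> u = lstat \<tau> u" if "u \<in> {1..2 * n}" for u
      using fun_cong[OF eq, of u] that by simp
    then have "\<forall>u\<in>{1..2 * n}. (in_descent (closed_word n \<tau>) u \<longleftrightarrow> u \<in> S)
        \<and> left (closed_word n \<tau>) u = lstat \<sigma> u"
      using word(3)[OF \<tau>] by simp
    with partial_word_unique_existence[OF S(1) _ _ word(4)[OF \<sigma>], of ?N]
    have "closed_word n \<sigma> = closed_word n \<tau>"
      using word(1,3)[OF \<sigma>] word(1)[OF \<tau>] by (simp add: Ex1_def) blast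
    then show "\<sigma> = \<tau>" using closed_word_inj word(2)[OF \<sigma>] word(2)[OF \<tau>] by blast
  qed
  show "(\<lambda>\<sigma>. restrict (lstat \<sigma>) {1..2 * n}) ` fibre n S = (\<Pi>\<^sub>E v\<in>{1..2 * n}. {..<nat (slots S v)})"
  proof (intro equalityI subsetI)
    fix l assume "l \<in> (\<lambda>\<sigma>. restrict (lstat \<sigma>) {1..2 * n}) ` fibre n S"
    then show "l \<in> (\<Pi>\<^sub>E v\<in>{1..2 * n}. {..<nat (slots S v)})"
      using word(4) by (fastforce simp: zless_nat_eq_int_zless)
  next
    fix l assume l: "l \<in> (\<Pi>\<^sub>E v\<in>{1..2 * n}. {..<nat (slots S v)})"
    then have "\<forall>u\<in>{1..2 * n}. int (l u) < slots S u"
      by (auto dest!: PiE_mem simp: zless_nat_eq_int_zless)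
    from ex1_implies_ex[OF partial_word_unique_existence[OF S(1) _ _ this, of ?N]]
    obtain W where W: "W \<in> partial_words ?N (2 * n)"
      "\<forall>u\<in>{1..2 * n}. (in_descent W u \<longleftrightarrow> u \<in> S) \<and> left W u = l u" by auto
    have "count_list W ?N = 1"
      using partial_word_slots[OF S(1) _ _ W(1)] W(2) S(3) by simp
    from closed_word_surj[OF W(1) this] obtain \<sigma>
      where \<sigma>: "\<sigma> permutes {1..2 * n}" "closed_word n \<sigma> = W" by blast
    have "S_set n \<sigma> = S"
      using S_set_subset[OF \<sigma>(1)] S(2) W(2) \<sigma>(2) in_descent_closed_word[of _ n \<sigma>] by blast
    then have "\<sigma> \<in> fibre n S"
      using X_perms_iff_closed_word[OF \<sigma>(1)] W(1) \<sigma>(2) by (simp add: fibre_def)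
    moreover have "l = restrict (lstat \<sigma>) {1..2 * n}"
    proof
      fix u show "l u = restrict (lstat \<sigma>) {1..2 * n} u"
        using W(2) \<sigma>(2) left_closed_word[OF \<sigma>(1), of u] PiE_arb[OF l, of u]
        by (cases "u \<in> {1..2 * n}") simp_all
    qed
    ultimately show "l \<in> (\<lambda>\<sigma>. restrict (lstat \<sigma>) {1..2 * n}) ` fibre n S" by blast
  qed
qed

text \<open>
  Because the values \<open>lstat \<sigma> v\<close> range independently over intervals, sums of products factor.
\<close>
lemma sum_fibre:
  fixes g :: "nat \<Rightarrow> nat \<Rightarrow> 'a::comm_semiring_1"
  assumes "S \<in> balanced n"
  shows "(\<Sum>\<sigma>\<in>fibre n S. \<Prod>v\<in>{1..2 * n}. g v (lstat \<sigma> v))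
    = (\<Prod>v\<in>{1..2 * n}. \<Sum>l<nat (slots S v). g v l)"
proof -
  have "(\<Sum>\<sigma>\<in>fibre n S. \<Prod>v\<in>{1..2 * n}. g v (lstat \<sigma> v))
      = (\<Sum>\<sigma>\<in>fibre n S. \<Prod>v\<in>{1..2 * n}. g v (restrict (lstat \<sigma>) {1..2 * n} v))"
    by (intro sum.cong prod.cong) auto
  also have "\<dots> = (\<Sum>l\<in>(\<Pi>\<^sub>E v\<in>{1..2 * n}. {..<nat (slots S v)}). \<Prod>v\<in>{1..2 * n}. g v (l v))"
    by (rule sum.reindex_bij_betw[OF lstat_bij_betw_fibre[OF assms]])
  also have "\<dots> = (\<Prod>v\<in>{1..2 * n}. \<Sum>l<nat (slots S v). g v l)"
    by (rule prod_sum_PiE[symmetric]) auto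
  finally show ?thesis .
qed

lemma stat_31_2_eq_sum:
  assumes "\<sigma> permutes {1..m}"
  shows "stat_31_2 m \<sigma> = (\<Sum>v\<in>{1..m}. lstat \<sigma> v)"
proof -
  let ?A = "\<lambda>j. {i. 2 \<le> i \<and> i < j \<and> \<sigma> (i - 1) > \<sigma> j \<and> \<sigma> j > \<sigma> i}"
  have fin: "finite (?A j)" for j by (rule finite_subset[of _ "{..j}"]) auto
  have "stat_31_2 m \<sigma> = card (prod.swap ` (SIGMA j:{1..m}. ?A j))"
    unfolding stat_31_2_def by (rule arg_cong[of _ _ card]) force
  also have "\<dots> = card (SIGMA j:{1..m}. ?A j)" by (simp add: card_image)
  also have "\<dots> = (\<Sum>j\<in>{1..m}. card (?A j))" using fin by simp
  also have "\<dots> = (\<Sum>j\<in>{1..m}. lstat \<sigma> (\<sigma> j))"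
    by (simp add: lstat_def permutes_inverses(2)[OF assms])
  also have "\<dots> = (\<Sum>v\<in>{1..m}. lstat \<sigma> v)"
    by (rule sum.reindex_bij_betw[OF permutes_imp_bij[OF assms]])
  finally show ?thesis .
qed

lemma stat_2_31_eq_sum:
  assumes "\<sigma> permutes {1..m}"
  shows "stat_2_31 m \<sigma> = (\<Sum>v\<in>{1..m}. rstat m \<sigma> v)"
proof -
  let ?A = "\<lambda>j. {i. j < i \<and> i \<le> m - 1 \<and> \<sigma> i > \<sigma> j \<and> \<sigma> j > \<sigma> (i + 1)}"
  have fin: "finite (?A j)" for j by (rule finite_subset[of _ "{..m - 1}"]) auto
  have "stat_2_31 m \<sigma> = card (SIGMA j:{1..m}. ?A j)"
    unfolding stat_2_31_def by (rule arg_cong[of _ _ card]) auto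
  also have "\<dots> = (\<Sum>j\<in>{1..m}. card (?A j))" using fin by simp
  also have "\<dots> = (\<Sum>j\<in>{1..m}. rstat m \<sigma> (\<sigma> j))"
    by (simp add: rstat_def permutes_inverses(2)[OF assms])
  also have "\<dots> = (\<Sum>v\<in>{1..m}. rstat m \<sigma> v)"
    by (rule sum.reindex_bij_betw[OF permutes_imp_bij[OF assms]])
  finally show ?thesis .
qed

text \<open>The \<open>(p,q)\<close>-analogue of the integer \<open>m\<close>.\<close>
definition pq_int :: "'a::comm_semiring_1 \<Rightarrow> 'a \<Rightarrow> nat \<Rightarrow> 'a" where
  "pq_int p q m = (\<Sum>l<m. p ^ (m - 1 - l) * q ^ l)"

lemma rstat_eq:
  assumes "\<sigma> \<in> fibre n S" "v \<in> {1..2 * n}"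
  shows "rstat (2 * n) \<sigma> v = nat (slots S v) - 1 - lstat \<sigma> v"
  using X_perms_slots(2)[of \<sigma> n v] assms by (auto simp: fibre_def)

lemma fibre_weight:
  fixes p q :: "'a::comm_semiring_1"
  assumes "S \<in> balanced n"
  shows "(\<Sum>\<sigma>\<in>fibre n S. p ^ stat_2_31 (2 * n) \<sigma> * q ^ stat_31_2 (2 * n) \<sigma>)
    = (\<Prod>v\<in>{1..2 * n}. pq_int p q (nat (slots S v)))"
proof -
  have "p ^ stat_2_31 (2 * n) \<sigma> * q ^ stat_31_2 (2 * n) \<sigma>
      = (\<Prod>v\<in>{1..2 * n}. p ^ (nat (slots S v) - 1 - lstat \<sigma> v) * q ^ lstat \<sigma> v)"
    if "\<sigma> \<in> fibre n S" for \<sigma>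
  proof -
    have "\<sigma> permutes {1..2 * n}" using that X_perms_permutes by (auto simp: fibre_def)
    then show ?thesis
      by (simp add: stat_31_2_eq_sum stat_2_31_eq_sum power_sum prod.distrib rstat_eq[OF that])
  qed
  then show ?thesis
    using sum_fibre[OF assms, where g = "\<lambda>v l. p ^ (nat (slots S v) - 1 - l) * q ^ l"]
    by (simp add: pq_int_def cong: sum.cong)
qed

section \<open>Removing complete pairs\<close>

text \<open>
  From here on the pair \<open>{2j-1, 2j}\<close> is indexed by \<open>i = j - 1\<close>, so that it reads
  \<open>{Suc (2 * i), Suc (Suc (2 * i))}\<close>.
\<close>
lemma excess_even_step:
  "excess S (Suc (2 * Suc i)) = excess S (Suc (2 * i))
     + of_bool (Suc (2 * i) \<in> S) - of_bool (Suc (Suc (2 * i)) \<in> S)"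
  using excess_Suc[of S "Suc (2 * i)"] excess_Suc[of S "Suc (Suc (2 * i))"] by simp

lemma slots_odd: "slots S (Suc (2 * i)) = excess S (Suc (2 * i)) + 1"
  by (simp add: slots_def)

lemma slots_even:
  "slots S (Suc (Suc (2 * i))) = excess S (Suc (2 * i)) + 1
     + of_bool (Suc (2 * i) \<in> S) - of_bool (Suc (Suc (2 * i)) \<in> S)"
  using excess_Suc[of S "Suc (2 * i)"] by (simp add: slots_def)

lemma Suc_le_twiceE:
  assumes "v \<in> {1..2 * n}"
  obtains i where "i < n" "v = Suc (2 * i)" | i where "i < n" "v = Suc (Suc (2 * i))"
proof (cases "even v")
  case True
  then obtain k where "v = 2 * k" by blast
  with assms show thesis by (intro that(2)[of "k - 1"]) auto
next
  case False
  then obtain k where "v = Suc (2 * k)" by (auto elim: oddE)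
  with assms show thesis by (intro that(1)[of k]) auto
qed

lemma sum_over_pairs:
  "(\<Sum>v\<in>{1..2 * n}. f v) = (\<Sum>i<n. f (Suc (2 * i)) + f (Suc (Suc (2 * i))))"
  for f :: "nat \<Rightarrow> 'b::comm_monoid_add"
  by (induction n) (simp_all add: ac_simps)

definition odd_part :: "nat set \<Rightarrow> nat set" where
  "odd_part S = {y \<in> S. odd y}"

lemma sum_of_bool_odd:
  assumes "S \<subseteq> {1..2 * n}"
  shows "card (odd_part S) = (\<Sum>i<n. of_bool (Suc (2 * i) \<in> S))"
proof -
  have "card (odd_part S) = (\<Sum>v\<in>{1..2 * n}. of_bool (v \<in> S \<and> odd v))"
    using assms by (simp add: of_bool_def sum.If_cases odd_part_def)
       (rule arg_cong[of _ _ card], auto)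
  also have "\<dots> = (\<Sum>i<n. of_bool (Suc (2 * i) \<in> S))"
    unfolding sum_over_pairs by simp
  finally show ?thesis .
qed

lemma balanced_even_card:
  assumes "S \<in> balanced n"
  shows "(\<Sum>i<n. of_bool (Suc (Suc (2 * i)) \<in> S)) = card (odd_part S)"
proof -
  have S: "S \<subseteq> {1..2 * n}" "excess S (Suc (2 * n)) = 0" using assms by (auto simp: balanced_def)
  have "{y \<in> S. odd y \<and> y < Suc (2 * n)} = odd_part S"
    "{y \<in> S. even y \<and> y < Suc (2 * n)} = {y \<in> S. even y}"
    using S(1) by (auto simp: odd_part_def)
  then have "card {y \<in> S. even y} = card (odd_part S)"
    using S(2) by (simp add: excess_def)
  moreover have "card {y \<in> S. even y} = (\<Sum>v\<in>{1..2 * n}. of_bool (v \<in> S \<and> even v))"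
    using S(1) by (simp add: of_bool_def sum.If_cases)
       (rule arg_cong[of _ _ card], auto)
  moreover have "\<dots> = (\<Sum>i<n. of_bool (Suc (Suc (2 * i)) \<in> S))"
    unfolding sum_over_pairs by simp
  ultimately show ?thesis by simp
qed

text \<open>
  Balanced sets without complete pairs: an element of \<open>\<X>\<^sub>2\<^sub>n\<close> is an \<open>\<E>\<close>-permutation if and only if
  its set \<open>S\<^sub>\<sigma>\<close> is of this kind.
\<close>
definition sparse :: "nat \<Rightarrow> nat set set" where
  "sparse n = {T \<in> balanced n. \<forall>i<n. \<not> (Suc (2 * i) \<in> T \<and> Suc (Suc (2 * i)) \<in> T)}"

definition free_pairs :: "nat \<Rightarrow> nat set \<Rightarrow> nat set" where
  "free_pairs n T = {i. i < n \<and> Suc (2 * i) \<notin> T \<and> Suc (Suc (2 * i)) \<notin> T}"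

definition pairs :: "nat set \<Rightarrow> nat set" where
  "pairs J = {v. v > 0 \<and> (v - 1) div 2 \<in> J}"

lemma mem_pairs [simp]:
  "Suc (2 * i) \<in> pairs J \<longleftrightarrow> i \<in> J" "Suc (Suc (2 * i)) \<in> pairs J \<longleftrightarrow> i \<in> J"
  by (auto simp: pairs_def)

lemma finite_balanced [simp]: "finite (balanced n)"
  by (rule finite_subset[of _ "Pow {1..2 * n}"]) (auto simp: balanced_def)

lemma finite_sparse [simp]: "finite (sparse n)"
  by (rule finite_subset[of _ "balanced n"]) (auto simp: sparse_def)

lemma finite_free_pairs [simp]: "finite (free_pairs n T)"
  by (rule finite_subset[of _ "{..<n}"]) (auto simp: free_pairs_def)

lemma card_free_pairs:
  assumes "T \<in> sparse n"
  shows "card (free_pairs n T) + 2 * card (odd_part T) = n"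
proof -
  have T: "T \<in> balanced n" "T \<subseteq> {1..2 * n}"
    "\<And>i. i < n \<Longrightarrow> \<not> (Suc (2 * i) \<in> T \<and> Suc (Suc (2 * i)) \<in> T)"
    using assms by (auto simp: sparse_def balanced_def)
  have "card (free_pairs n T) = (\<Sum>i<n. of_bool (i \<in> free_pairs n T))"
    by (simp add: of_bool_def sum.If_cases) (rule arg_cong[of _ _ card], auto simp: free_pairs_def)
  then have "card (free_pairs n T) + 2 * card (odd_part T)
      = (\<Sum>i<n. of_bool (i \<in> free_pairs n T) + of_bool (Suc (2 * i) \<in> T) + of_bool (Suc (Suc (2 * i)) \<in> T))"
    using sum_of_bool_odd[OF T(2)] balanced_even_card[OF T(1)] by (simp add: sum.distrib)
  also have "\<dots> = (\<Sum>i<n. 1)"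
  proof (rule sum.cong[OF refl])
    fix i assume "i \<in> {..<n}"
    then show "of_bool (i \<in> free_pairs n T) + of_bool (Suc (2 * i) \<in> T)
        + of_bool (Suc (Suc (2 * i)) \<in> T) = (1::nat)"
      using T(3)[of i] by (auto simp: free_pairs_def)
  qed
  finally show ?thesis by simp
qed

lemma excess_add_pairs:
  assumes "J \<subseteq> free_pairs n T" "i \<le> n" "0 \<notin> T"
  shows "excess (T \<union> pairs J) (Suc (2 * i)) = excess T (Suc (2 * i))"
  using assms(2)
proof (induction i)
  case 0
  have "0 \<notin> T \<union> pairs J" using assms(3) by (simp add: pairs_def)
  then show ?case using excess_1 assms(3) by simp
next
  case (Suc i)
  have "i \<in> J \<Longrightarrow> Suc (2 * i) \<notin> T \<and> Suc (Suc (2 * i)) \<notin> T"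
    using assms(1) by (auto simp: free_pairs_def)
  with Suc show ?case unfolding excess_even_step[of _ i] by auto
qed

text \<open>
  A complete pair changes neither the excess beyond it nor the number of slots inside it: at its
  even element, the increase of the excess by its odd element is offset by the loss of the last
  slot.
\<close>
lemma slots_add_pairs:
  assumes "J \<subseteq> free_pairs n T" "v \<in> {1..2 * n}" "0 \<notin> T"
  shows "slots (T \<union> pairs J) v = slots T v"
proof -
  have free: "i \<in> J \<Longrightarrow> Suc (2 * i) \<notin> T \<and> Suc (Suc (2 * i)) \<notin> T" for i
    using assms(1) by (auto simp: free_pairs_def)
  note ex = excess_add_pairs[OF assms(1) _ assms(3)]
  from assms(2) show ?thesis
    by (cases rule: Suc_le_twiceE) (use ex free in \<open>auto simp: slots_odd slots_even\<close>)
qed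

lemma pairs_subset: "J \<subseteq> {..<n} \<Longrightarrow> pairs J \<subseteq> {1..2 * n}"
  by (auto simp: pairs_def subset_iff)

definition full_pairs :: "nat \<Rightarrow> nat set \<Rightarrow> nat set" where
  "full_pairs n S = {i. i < n \<and> Suc (2 * i) \<in> S \<and> Suc (Suc (2 * i)) \<in> S}"

lemma pairs_full_pairs_subset: "pairs (full_pairs n S) \<subseteq> S"
proof
  fix v assume v: "v \<in> pairs (full_pairs n S)"
  have "full_pairs n S \<subseteq> {..<n}" by (auto simp: full_pairs_def)
  with v have "v \<in> {1..2 * n}" using pairs_subset by blast
  then show "v \<in> S" by (cases rule: Suc_le_twiceE) (use v in \<open>auto simp: full_pairs_def\<close>)
qed

lemma pairs_free_pairs_disjoint:
  assumes "T \<subseteq> {1..2 * n}" "J \<subseteq> free_pairs n T"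
  shows "T \<inter> pairs J = {}"
proof -
  have "v \<notin> pairs J" if "v \<in> T" for v
  proof -
    have "v \<in> {1..2 * n}" using assms(1) that by auto
    then show ?thesis
      by (cases rule: Suc_le_twiceE) (use assms(2) that in \<open>auto simp: free_pairs_def\<close>)
  qed
  then show ?thesis by blast
qed

lemma add_pairs_in_balanced_iff:
  assumes "T \<subseteq> {1..2 * n}" "J \<subseteq> free_pairs n T"
  shows "T \<union> pairs J \<in> balanced n \<longleftrightarrow> T \<in> balanced n"
proof -
  have "0 \<notin> T" using assms(1) by auto
  from excess_add_pairs[OF assms(2) le_refl this]
  have "excess (T \<union> pairs J) (Suc (2 * n)) = excess T (Suc (2 * n))" .
  moreover have "J \<subseteq> {..<n}" using assms(2) by (auto simp: free_pairs_def)
  ultimately show ?thesis using assms(1) pairs_subset[of J n] by (auto simp: balanced_def)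
qed

text \<open>
  The inverse splits a balanced set into its complete pairs and the rest.
\<close>
lemma balanced_bij_sparse:
  "bij_betw (\<lambda>(T, J). T \<union> pairs J) (SIGMA T:sparse n. Pow (free_pairs n T)) (balanced n)"
proof (rule bij_betw_byWitness[where f' = "\<lambda>S. (S - pairs (full_pairs n S), full_pairs n S)"])
  let ?f = "\<lambda>(T, J). T \<union> pairs J" and ?g = "\<lambda>S. (S - pairs (full_pairs n S), full_pairs n S)"
  have sparse_sub: "T \<subseteq> {1..2 * n}" if "T \<in> sparse n" for T
    using that by (simp add: sparse_def balanced_def)
  show "\<forall>a\<in>SIGMA T:sparse n. Pow (free_pairs n T). ?g (?f a) = a"
  proof
    fix a assume "a \<in> (SIGMA T:sparse n. Pow (free_pairs n T))"
    then obtain T J where a: "a = (T, J)" and T: "T \<in> sparse n" and J: "J \<subseteq> free_pairs n T"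
      by auto
    have "full_pairs n (T \<union> pairs J) = J"
      using T J by (auto simp: sparse_def free_pairs_def full_pairs_def)
    moreover have "T \<union> pairs J - pairs J = T"
      using pairs_free_pairs_disjoint[OF sparse_sub[OF T] J] by blast
    ultimately show "?g (?f a) = a" by (simp add: a)
  qed
  show "\<forall>S\<in>balanced n. ?f (?g S) = S"
    using pairs_full_pairs_subset by auto
  show "?f ` (SIGMA T:sparse n. Pow (free_pairs n T)) \<subseteq> balanced n"
  proof
    fix S assume "S \<in> ?f ` (SIGMA T:sparse n. Pow (free_pairs n T))"
    then obtain T J where S: "S = T \<union> pairs J" and T: "T \<in> sparse n" and J: "J \<subseteq> free_pairs n T"
      by auto
    then show "S \<in> balanced n"
      using add_pairs_in_balanced_iff[OF sparse_sub[OF T] J] by (simp add: sparse_def)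
  qed
  show "?g ` balanced n \<subseteq> (SIGMA T:sparse n. Pow (free_pairs n T))"
  proof
    fix a assume "a \<in> ?g ` balanced n"
    then obtain S where S: "S \<in> balanced n" and a: "a = ?g S" by blast
    let ?T = "S - pairs (full_pairs n S)"
    have T: "?T \<subseteq> {1..2 * n}" using S by (auto simp: balanced_def)
    have free: "full_pairs n S \<subseteq> free_pairs n ?T" by (auto simp: free_pairs_def full_pairs_def)
    have "?T \<union> pairs (full_pairs n S) = S" using pairs_full_pairs_subset[of n S] by blast
    then have "?T \<in> balanced n" using add_pairs_in_balanced_iff[OF T free] S by simp
    then have "?T \<in> sparse n" by (auto simp: sparse_def full_pairs_def)
    with free show "a \<in> (SIGMA T:sparse n. Pow (free_pairs n T))" by (simp add: a)
  qed
qed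

lemma card_odd_part_add_pairs:
  assumes "T \<in> sparse n" "J \<subseteq> free_pairs n T"
  shows "card (odd_part (T \<union> pairs J)) = card (odd_part T) + card J"
proof -
  have T: "T \<subseteq> {1..2 * n}" using assms(1) by (auto simp: sparse_def balanced_def)
  have J: "J \<subseteq> {..<n}" using assms(2) by (auto simp: free_pairs_def)
  have "card J = (\<Sum>i<n. of_bool (i \<in> J))"
    using J by (simp add: of_bool_def sum.If_cases Int_absorb1)
  moreover have "of_bool (Suc (2 * i) \<in> T \<union> pairs J) = of_bool (Suc (2 * i) \<in> T) + (of_bool (i \<in> J)::nat)" for i
    using assms(2) by (auto simp: free_pairs_def)
  ultimately show ?thesis
    using sum_of_bool_odd[of "T \<union> pairs J" n] sum_of_bool_odd[OF T] T pairs_subset[OF J]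
    by (simp add: sum.distrib)
qed

lemma sum_power_card_Pow:
  fixes t :: "'a::comm_semiring_1"
  assumes "finite A"
  shows "(\<Sum>J\<in>Pow A. t ^ card J) = (1 + t) ^ card A"
  using prod_add[OF assms, of "\<lambda>_. t" "\<lambda>_. 1"] by (simp add: add.commute)

definition slot_weight :: "nat \<Rightarrow> 'a::comm_semiring_1 \<Rightarrow> 'a \<Rightarrow> nat set \<Rightarrow> 'a" where
  "slot_weight n p q S = (\<Prod>v\<in>{1..2 * n}. pq_int p q (nat (slots S v)))"

text \<open>
  Each free pair may be added or not; it contributes a factor \<open>t\<close> or \<open>1\<close> and leaves the slots
  unchanged.
\<close>
lemma sum_balanced_eq_sum_sparse:
  fixes p q t :: "'a::comm_semiring_1"
  shows "(\<Sum>S\<in>balanced n. t ^ card (odd_part S) * slot_weight n p q S)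
    = (\<Sum>T\<in>sparse n. t ^ card (odd_part T) * (1 + t) ^ (n - 2 * card (odd_part T)) * slot_weight n p q T)"
proof -
  have "(\<Sum>S\<in>balanced n. t ^ card (odd_part S) * slot_weight n p q S)
      = (\<Sum>(T, J)\<in>(SIGMA T:sparse n. Pow (free_pairs n T)).
          t ^ card (odd_part (T \<union> pairs J)) * slot_weight n p q (T \<union> pairs J))"
    by (subst sum.reindex_bij_betw[OF balanced_bij_sparse, symmetric]) (simp add: case_prod_unfold)
  also have "\<dots> = (\<Sum>T\<in>sparse n. \<Sum>J\<in>Pow (free_pairs n T).
          t ^ card (odd_part (T \<union> pairs J)) * slot_weight n p q (T \<union> pairs J))"
    by (simp add: sum.Sigma)
  also have "\<dots> = (\<Sum>T\<in>sparse n. t ^ card (odd_part T) * (1 + t) ^ (n - 2 * card (odd_part T)) * slot_weight n p q T)"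
  proof (rule sum.cong[OF refl])
    fix T assume T: "T \<in> sparse n"
    then have "0 \<notin> T" by (auto simp: sparse_def balanced_def)
    then have "slot_weight n p q (T \<union> pairs J) = slot_weight n p q T" if "J \<subseteq> free_pairs n T" for J
      unfolding slot_weight_def using slots_add_pairs[OF that] by (intro prod.cong) auto
    then have "(\<Sum>J\<in>Pow (free_pairs n T).
          t ^ card (odd_part (T \<union> pairs J)) * slot_weight n p q (T \<union> pairs J))
        = (\<Sum>J\<in>Pow (free_pairs n T). t ^ card (odd_part T) * slot_weight n p q T * t ^ card J)"
      using card_odd_part_add_pairs[OF T] by (intro sum.cong) (auto simp: power_add ac_simps)
    also have "\<dots> = t ^ card (odd_part T) * slot_weight n p q T * (1 + t) ^ card (free_pairs n T)"
      by (simp add: sum_distrib_left[symmetric] sum_power_card_Pow)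
    also have "card (free_pairs n T) = n - 2 * card (odd_part T)"
      using card_free_pairs[OF T] by simp
    finally show "(\<Sum>J\<in>Pow (free_pairs n T).
          t ^ card (odd_part (T \<union> pairs J)) * slot_weight n p q (T \<union> pairs J))
        = t ^ card (odd_part T) * (1 + t) ^ (n - 2 * card (odd_part T)) * slot_weight n p q T"
      by (simp add: ac_simps)
  qed
  finally show ?thesis .
qed

section \<open>The \<open>\<gamma>\<close>-expansion\<close>

lemma X_perms_parity:
  assumes "\<sigma> \<in> X_perms n"
  shows "odd x \<Longrightarrow> x \<in> S_set n \<sigma> \<longleftrightarrow> x \<in> bottoms (2 * n) \<sigma>"
    and "even x \<Longrightarrow> x \<in> S_set n \<sigma> \<longleftrightarrow> x \<in> tops (2 * n) \<sigma>"
    and "x \<in> bottoms (2 * n) \<sigma> \<Longrightarrow> odd x"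
proof -
  have "\<forall>x\<in>tops (2 * n) \<sigma>. even x" "\<forall>x\<in>bottoms (2 * n) \<sigma>. odd x"
    using assms by (auto simp: X_perms_def tops_def bottoms_def)
  then show "odd x \<Longrightarrow> x \<in> S_set n \<sigma> \<longleftrightarrow> x \<in> bottoms (2 * n) \<sigma>"
    "even x \<Longrightarrow> x \<in> S_set n \<sigma> \<longleftrightarrow> x \<in> tops (2 * n) \<sigma>"
    "x \<in> bottoms (2 * n) \<sigma> \<Longrightarrow> odd x"
    by (auto simp: S_set_def)
qed

text \<open>A descent is determined by its bottom, and the bottoms are the odd elements of \<open>S\<^sub>\<sigma>\<close>.\<close>
lemma des_eq_card_odd_part:
  assumes "\<sigma> \<in> X_perms n"
  shows "des (2 * n) \<sigma> = card (odd_part (S_set n \<sigma>))"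
proof -
  have "inj_on snd (descents (2 * n) \<sigma>)"
    using permutes_inj[OF X_perms_permutes[OF assms]] by (auto simp: descents_def inj_on_def)
  then have "des (2 * n) \<sigma> = card (bottoms (2 * n) \<sigma>)"
    by (simp add: des_def bottoms_def card_image)
  also have "bottoms (2 * n) \<sigma> = odd_part (S_set n \<sigma>)"
    using X_perms_parity[OF assms] by (auto simp: odd_part_def)
  finally show ?thesis .
qed

lemma ball_Suc_iff: "(\<forall>j\<in>{1..n}. P j) \<longleftrightarrow> (\<forall>i<n. P (Suc i))"
proof
  assume *: "\<forall>i<n. P (Suc i)"
  show "\<forall>j\<in>{1..n}. P j"
  proof
    fix j assume "j \<in> {1..n}"
    then obtain i where "j = Suc i" "i < n" by (cases j) auto
    then show "P j" using * by simp
  qed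
qed auto

lemma ball_over_pairs:
  "(\<forall>v\<in>{1..2 * n}. P v) \<longleftrightarrow> (\<forall>i<n. P (Suc (2 * i)) \<and> P (Suc (Suc (2 * i))))"
proof
  assume *: "\<forall>i<n. P (Suc (2 * i)) \<and> P (Suc (Suc (2 * i)))"
  show "\<forall>v\<in>{1..2 * n}. P v"
  proof
    fix v assume "v \<in> {1..2 * n}"
    then show "P v" by (cases rule: Suc_le_twiceE) (use * in auto)
  qed
qed auto

lemma E_perms_iff:
  assumes "\<sigma> \<in> X_perms n"
  shows "\<sigma> \<in> E_perms n \<longleftrightarrow> S_set n \<sigma> \<in> sparse n"
proof -
  have "\<sigma> \<in> E_perms n \<longleftrightarrow>
      (\<forall>j\<in>{1..n}. \<not> (2 * j - 1 \<in> bottoms (2 * n) \<sigma> \<and> 2 * j \<in> tops (2 * n) \<sigma>))"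
    using assms by (auto simp: E_perms_def)
  also have "\<dots> \<longleftrightarrow> (\<forall>i<n. \<not> (Suc (2 * i) \<in> S_set n \<sigma> \<and> Suc (Suc (2 * i)) \<in> S_set n \<sigma>))"
    unfolding ball_Suc_iff using X_perms_parity[OF assms] by simp
  also have "\<dots> \<longleftrightarrow> S_set n \<sigma> \<in> sparse n"
    using X_perms_slots(1)[OF assms] by (simp add: sparse_def)
  finally show ?thesis .
qed

lemma finite_X_perms: "finite (X_perms n)"
  by (rule finite_subset[OF _ finite_permutations[of "{1..2 * n}"]]) (auto simp: X_perms_def)

lemma sum_X_perms:
  fixes p q t :: "'a::comm_semiring_1"
  shows "(\<Sum>\<sigma>\<in>X_perms n. p ^ stat_2_31 (2 * n) \<sigma> * q ^ stat_31_2 (2 * n) \<sigma> * t ^ des (2 * n) \<sigma>)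
    = (\<Sum>S\<in>balanced n. t ^ card (odd_part S) * slot_weight n p q S)"
proof -
  have "(\<Sum>\<sigma>\<in>X_perms n. p ^ stat_2_31 (2 * n) \<sigma> * q ^ stat_31_2 (2 * n) \<sigma> * t ^ des (2 * n) \<sigma>)
      = (\<Sum>S\<in>balanced n. \<Sum>\<sigma>\<in>fibre n S.
          p ^ stat_2_31 (2 * n) \<sigma> * q ^ stat_31_2 (2 * n) \<sigma> * t ^ des (2 * n) \<sigma>)"
    unfolding fibre_def
    by (rule sum.group[symmetric]) (auto simp: finite_X_perms X_perms_slots(1))
  also have "\<dots> = (\<Sum>S\<in>balanced n. t ^ card (odd_part S) * slot_weight n p q S)"
  proof (rule sum.cong[OF refl])
    fix S assume S: "S \<in> balanced n"
    have "(\<Sum>\<sigma>\<in>fibre n S. p ^ stat_2_31 (2 * n) \<sigma> * q ^ stat_31_2 (2 * n) \<sigma> * t ^ des (2 * n) \<sigma>)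
        = (\<Sum>\<sigma>\<in>fibre n S. p ^ stat_2_31 (2 * n) \<sigma> * q ^ stat_31_2 (2 * n) \<sigma>) * t ^ card (odd_part S)"
      unfolding sum_distrib_right
      by (rule sum.cong[OF refl]) (auto simp: fibre_def des_eq_card_odd_part)
    then show "(\<Sum>\<sigma>\<in>fibre n S. p ^ stat_2_31 (2 * n) \<sigma> * q ^ stat_31_2 (2 * n) \<sigma> * t ^ des (2 * n) \<sigma>)
        = t ^ card (odd_part S) * slot_weight n p q S"
      unfolding fibre_weight[OF S] slot_weight_def by (simp add: mult.commute)
  qed
  finally show ?thesis .
qed

definition sparse_card :: "nat \<Rightarrow> nat \<Rightarrow> nat set set" where
  "sparse_card n k = {T \<in> sparse n. card (odd_part T) = k}"

lemma sum_over_sparse_fibres: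
  fixes f :: "(nat \<Rightarrow> nat) \<Rightarrow> 'a::comm_monoid_add"
  shows "(\<Sum>\<sigma>\<in>{\<sigma> \<in> E_perms_des n k. P \<sigma>}. f \<sigma>)
    = (\<Sum>T\<in>sparse_card n k. \<Sum>\<sigma>\<in>{\<sigma> \<in> fibre n T. P \<sigma>}. f \<sigma>)"
proof -
  let ?A = "{\<sigma> \<in> E_perms_des n k. P \<sigma>}"
  have E: "\<sigma> \<in> E_perms_des n k \<longleftrightarrow> \<sigma> \<in> X_perms n \<and> S_set n \<sigma> \<in> sparse_card n k" for \<sigma>
    using E_perms_iff[of \<sigma> n] des_eq_card_odd_part[of \<sigma> n]
    by (auto simp: E_perms_des_def sparse_card_def E_perms_def)
  have "(\<Sum>\<sigma>\<in>?A. f \<sigma>) = (\<Sum>T\<in>sparse_card n k. \<Sum>\<sigma>\<in>{\<sigma> \<in> ?A. S_set n \<sigma> = T}. f \<sigma>)"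
  proof (rule sum.group[symmetric])
    show "finite ?A" by (rule finite_subset[OF _ finite_X_perms[of n]]) (use E in auto)
    show "finite (sparse_card n k)" by (simp add: sparse_card_def)
    show "S_set n ` ?A \<subseteq> sparse_card n k" using E by auto
  qed
  also have "\<dots> = (\<Sum>T\<in>sparse_card n k. \<Sum>\<sigma>\<in>{\<sigma> \<in> fibre n T. P \<sigma>}. f \<sigma>)"
    by (intro sum.cong refl) (use E in \<open>auto simp: fibre_def\<close>)
  finally show ?thesis .
qed

lemma gamma_coeff_eq_sum:
  fixes p q :: "'a::comm_ring_1"
  shows "gamma_coeff n k p q = (\<Sum>T\<in>sparse_card n k. slot_weight n p q T)"
proof -
  have "gamma_coeff n k p q = (\<Sum>T\<in>sparse_card n k. \<Sum>\<sigma>\<in>{\<sigma> \<in> fibre n T. True}.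
      p ^ stat_2_31 (2 * n) \<sigma> * q ^ stat_31_2 (2 * n) \<sigma>)"
    unfolding gamma_coeff_def sum_over_sparse_fibres[symmetric] by simp
  also have "\<dots> = (\<Sum>T\<in>sparse_card n k. slot_weight n p q T)"
    by (intro sum.cong refl)
      (simp add: sparse_card_def sparse_def slot_weight_def fibre_weight)
  finally show ?thesis .
qed

section \<open>The factorization of the coefficients\<close>

text \<open>
  In the pair of \<open>v\<close>, whose odd element is \<open>Suc (2 * ((v - 1) div 2))\<close>, the odd element
  may belong to \<open>T\<close> (a descent is opened) or the even one may (a descent is closed). In both cases
  the conditions defining normalized permutations constrain only the member of the pair with an
  even number of slots, which the two predicates single out.
\<close>
definition opens :: "nat set \<Rightarrow> nat \<Rightarrow> bool" where
  "opens T v \<longleftrightarrow> Suc (2 * ((v - 1) div 2)) \<in> T \<and> even (slots T v)"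

definition closes :: "nat set \<Rightarrow> nat \<Rightarrow> bool" where
  "closes T v \<longleftrightarrow> Suc (Suc (2 * ((v - 1) div 2))) \<in> T \<and> even (slots T v)"

lemma opens_closes_simps:
  "opens T (Suc (2 * i)) \<longleftrightarrow> Suc (2 * i) \<in> T \<and> even (slots T (Suc (2 * i)))"
  "opens T (Suc (Suc (2 * i))) \<longleftrightarrow> Suc (2 * i) \<in> T \<and> even (slots T (Suc (Suc (2 * i))))"
  "closes T (Suc (2 * i)) \<longleftrightarrow> Suc (Suc (2 * i)) \<in> T \<and> even (slots T (Suc (2 * i)))"
  "closes T (Suc (Suc (2 * i))) \<longleftrightarrow> Suc (Suc (2 * i)) \<in> T \<and> even (slots T (Suc (Suc (2 * i))))"
  by (simp_all add: opens_def closes_def)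

text \<open>
  If exactly one element of a pair belongs to \<open>T\<close>, the numbers of slots of its two members differ by
  one. This is why the conditions of normalization, which test the parity of \<open>s\<close> at the element of
  \<open>T\<close>, can be read as conditions on the member with an even number of slots.
\<close>
lemma sparse_slots_parity:
  assumes "T \<in> sparse n" "i < n" "Suc (2 * i) \<in> T \<or> Suc (Suc (2 * i)) \<in> T"
  shows "even (slots T (Suc (Suc (2 * i)))) \<longleftrightarrow> odd (slots T (Suc (2 * i)))"
proof -
  have "\<not> (Suc (2 * i) \<in> T \<and> Suc (Suc (2 * i)) \<in> T)" using assms(1,2) by (auto simp: sparse_def)
  with assms(3) show ?thesis by (auto simp: slots_odd slots_even)
qed

lemma sum_opens:
  assumes "T \<in> sparse n"
  shows "(\<Sum>v\<in>{1..2 * n}. of_bool (opens T v)) = card (odd_part T)"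
    and "(\<Sum>v\<in>{1..2 * n}. of_bool (closes T v)) = card (odd_part T)"
proof -
  have T: "T \<in> balanced n" "T \<subseteq> {1..2 * n}" using assms by (auto simp: sparse_def balanced_def)
  note par = sparse_slots_parity[OF assms]
  have "(\<Sum>v\<in>{1..2 * n}. of_bool (opens T v)) = (\<Sum>i<n. of_bool (Suc (2 * i) \<in> T) :: nat)"
    unfolding sum_over_pairs
  proof (rule sum.cong[OF refl])
    fix i assume "i \<in> {..<n}"
    then show "of_bool (opens T (Suc (2 * i))) + of_bool (opens T (Suc (Suc (2 * i))))
        = (of_bool (Suc (2 * i) \<in> T) :: nat)"
      using par[of i] by (auto simp: opens_closes_simps)
  qed
  then show "(\<Sum>v\<in>{1..2 * n}. of_bool (opens T v)) = card (odd_part T)"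
    using sum_of_bool_odd[OF T(2)] by simp
  have "(\<Sum>v\<in>{1..2 * n}. of_bool (closes T v)) = (\<Sum>i<n. of_bool (Suc (Suc (2 * i)) \<in> T) :: nat)"
    unfolding sum_over_pairs
  proof (rule sum.cong[OF refl])
    fix i assume "i \<in> {..<n}"
    then show "of_bool (closes T (Suc (2 * i))) + of_bool (closes T (Suc (Suc (2 * i))))
        = (of_bool (Suc (Suc (2 * i)) \<in> T) :: nat)"
      using par[of i] by (auto simp: opens_closes_simps)
  qed
  then show "(\<Sum>v\<in>{1..2 * n}. of_bool (closes T v)) = card (odd_part T)"
    using balanced_even_card[OF T(1)] by simp
qed

lemma sparse_not_opens_and_closes:
  assumes "T \<in> sparse n" "v \<in> {1..2 * n}"
  shows "\<not> (opens T v \<and> closes T v)"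
  using assms(2)
  by (cases rule: Suc_le_twiceE) (use assms(1) in \<open>auto simp: opens_closes_simps sparse_def\<close>)

definition normal_at :: "nat set \<Rightarrow> nat \<Rightarrow> nat \<Rightarrow> nat \<Rightarrow> bool" where
  "normal_at T v l r \<longleftrightarrow> (opens T v \<longrightarrow> even l) \<and> (closes T v \<longrightarrow> even r)"

lemma normalized_iff:
  assumes "\<sigma> \<in> fibre n T" "T \<in> sparse n"
  shows "normalized n \<sigma> \<longleftrightarrow> (\<forall>v\<in>{1..2 * n}. normal_at T v (lstat \<sigma> v) (rstat (2 * n) \<sigma> v))"
proof -
  have S: "S_set n \<sigma> = T" using assms(1) by (simp add: fibre_def)
  have s: "s_val n \<sigma> x = slots T x" for x
    by (simp add: s_val_def slots_def excess_def S)
  show ?thesis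
    unfolding normalized_def S s ball_over_pairs ball_Suc_iff[of n]
  proof (rule all_cong)
    fix i assume "i < n"
    note par = sparse_slots_parity[OF assms(2) this]
    have "2 * Suc i - 1 = Suc (2 * i)" "2 * Suc i = Suc (Suc (2 * i))" by auto
    then show "((2 * Suc i - 1 \<in> T \<and> odd (slots T (2 * Suc i - 1)) \<longrightarrow> even (lstat \<sigma> (2 * Suc i))) \<and>
        (2 * Suc i - 1 \<in> T \<and> even (slots T (2 * Suc i - 1)) \<longrightarrow> even (lstat \<sigma> (2 * Suc i - 1))) \<and>
        (2 * Suc i \<in> T \<and> odd (slots T (2 * Suc i)) \<longrightarrow> even (rstat (2 * n) \<sigma> (2 * Suc i - 1))) \<and>
        (2 * Suc i \<in> T \<and> even (slots T (2 * Suc i)) \<longrightarrow> even (rstat (2 * n) \<sigma> (2 * Suc i)))) =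
       (normal_at T (Suc (2 * i)) (lstat \<sigma> (Suc (2 * i))) (rstat (2 * n) \<sigma> (Suc (2 * i))) \<and>
        normal_at T (Suc (Suc (2 * i))) (lstat \<sigma> (Suc (Suc (2 * i))))
         (rstat (2 * n) \<sigma> (Suc (Suc (2 * i)))))"
      using par by (simp only: normal_at_def opens_closes_simps) blast
  qed
qed

text \<open>
  At the distinguished member \<open>l + r = s - 1\<close> is odd, so if one of \<open>l\<close>, \<open>r\<close> is even then the other
  one is at least \<open>1\<close>. This provides the factor \<open>p\<close> or \<open>q\<close> that is split off.
\<close>
lemma normal_at_bounds:
  assumes "normal_at T v l r" "int l + int r + 1 = slots T v"
  shows "of_bool (closes T v) \<le> l" "of_bool (opens T v) \<le> r"
proof -
  have "odd (l + r)" if "even (slots T v)"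
    using that unfolding assms(2)[symmetric] by presburger
  then have "closes T v \<Longrightarrow> odd l" "opens T v \<Longrightarrow> odd r"
    using assms(1) by (auto simp: normal_at_def opens_def closes_def)
  then show "of_bool (closes T v) \<le> l" "of_bool (opens T v) \<le> r"
    by (auto simp: of_bool_def Suc_le_eq odd_pos)
qed

definition normal_weight :: "'a::comm_semiring_1 \<Rightarrow> 'a \<Rightarrow> nat set \<Rightarrow> nat \<Rightarrow> nat \<Rightarrow> nat \<Rightarrow> 'a" where
  "normal_weight p q T v l r =
     (if normal_at T v l r
      then q ^ (l - of_bool (closes T v)) * p ^ (r - of_bool (opens T v)) else 0)"

lemma sum_lessThan_twice:
  "(\<Sum>l<2 * m. f l) = (\<Sum>i<m. f (2 * i) + f (Suc (2 * i)))" for f :: "nat \<Rightarrow> 'b::comm_monoid_add"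
  by (induction m) (simp_all add: ac_simps)

text \<open>Consecutive terms of \<open>[2m]\<close> are grouped in twos.\<close>
lemma pq_int_twice:
  "pq_int p q (2 * m) = (p + q) * (\<Sum>i<m. q ^ (2 * i) * p ^ (2 * m - 2 - 2 * i))"
  for p q :: "'a::comm_semiring_1"
proof -
  have "p ^ (2 * m - 1 - 2 * i) * q ^ (2 * i) + p ^ (2 * m - 1 - Suc (2 * i)) * q ^ Suc (2 * i)
      = (p + q) * (q ^ (2 * i) * p ^ (2 * m - 2 - 2 * i))" if "i < m" for i
  proof -
    have "2 * m - 1 - 2 * i = Suc (2 * m - 2 - 2 * i)" "2 * m - 1 - Suc (2 * i) = 2 * m - 2 - 2 * i"
      using that by auto
    then show ?thesis by (simp add: algebra_simps)
  qed
  then show ?thesis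
    unfolding pq_int_def sum_lessThan_twice sum_distrib_left by (intro sum.cong) auto
qed

text \<open>
  If \<open>v\<close> opens or closes, the normal choices are every second term of \<open>[s]\<close>: the even values of \<open>l\<close> with one
  factor \<open>p\<close> removed, or the odd values of \<open>l\<close> with one factor \<open>q\<close> removed. The results agree with
  the sum in \<open>pq_int_twice\<close>.
\<close>
lemma sum_normal_weight:
  fixes p q :: "'a::comm_semiring_1"
  assumes "T \<in> sparse n" "v \<in> {1..2 * n}"
  defines "s \<equiv> nat (slots T v)"
  shows "(p + q) ^ (of_bool (opens T v) + of_bool (closes T v))
      * (\<Sum>l<s. normal_weight p q T v l (s - 1 - l)) = pq_int p q s"
proof -
  have even_s: "\<exists>m. s = 2 * m" if "even (slots T v)"
  proof (cases "slots T v \<ge> 0")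
    case True
    then show ?thesis using that unfolding s_def by (metis even_nat_iff dvd_def)
  qed (simp add: s_def)
  consider (op) "opens T v" "\<not> closes T v" | (cl) "\<not> opens T v" "closes T v"
    | (none) "\<not> opens T v" "\<not> closes T v"
    using sparse_not_opens_and_closes[OF assms(1,2)] by blast
  then show ?thesis
  proof cases
    case op
    then obtain m where m: "s = 2 * m" using even_s by (auto simp: opens_def)
    have "(\<Sum>l<2 * m. normal_weight p q T v l (2 * m - 1 - l))
        = (\<Sum>i<m. q ^ (2 * i) * p ^ (2 * m - 2 - 2 * i))"
      unfolding sum_lessThan_twice
      by (rule sum.cong) (simp_all add: normal_weight_def normal_at_def op diff_diff_eq)
    then show ?thesis using op by (simp add: m pq_int_twice)
  next
    case cl
    then obtain m where m: "s = 2 * m" using even_s by (auto simp: closes_def)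
    have "normal_weight p q T v (2 * i) (2 * m - 1 - 2 * i)
        + normal_weight p q T v (Suc (2 * i)) (2 * m - 1 - Suc (2 * i))
        = q ^ (2 * i) * p ^ (2 * m - 2 - 2 * i)" if "i < m" for i
    proof -
      have "2 * m - 1 - 2 * i = Suc (2 * (m - 1 - i))" "2 * m - 1 - Suc (2 * i) = 2 * (m - 1 - i)"
        "2 * m - 2 - 2 * i = 2 * (m - 1 - i)"
        using that by auto
      then show ?thesis by (simp add: normal_weight_def normal_at_def cl)
    qed
    then have "(\<Sum>l<2 * m. normal_weight p q T v l (2 * m - 1 - l))
        = (\<Sum>i<m. q ^ (2 * i) * p ^ (2 * m - 2 - 2 * i))"
      unfolding sum_lessThan_twice by (intro sum.cong) auto
    then show ?thesis using cl by (simp add: m pq_int_twice)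
  next
    case none
    then show ?thesis by (simp add: normal_weight_def normal_at_def pq_int_def mult.commute)
  qed
qed

lemma normalized_stats:
  assumes "\<sigma> \<in> fibre n T" "T \<in> sparse_card n k" "normalized n \<sigma>"
  shows "k \<le> stat_31_2 (2 * n) \<sigma>" "k \<le> stat_2_31 (2 * n) \<sigma>"
    "stat_31_2 (2 * n) \<sigma> - k = (\<Sum>v\<in>{1..2 * n}. lstat \<sigma> v - of_bool (closes T v))"
    "stat_2_31 (2 * n) \<sigma> - k = (\<Sum>v\<in>{1..2 * n}. rstat (2 * n) \<sigma> v - of_bool (opens T v))"
proof -
  have T: "T \<in> sparse n" "card (odd_part T) = k" using assms(2) by (auto simp: sparse_card_def)
  have X: "\<sigma> \<in> X_perms n" "S_set n \<sigma> = T" using assms(1) by (auto simp: fibre_def)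
  have bound: "of_bool (closes T v) \<le> lstat \<sigma> v" "of_bool (opens T v) \<le> rstat (2 * n) \<sigma> v"
    if "v \<in> {1..2 * n}" for v
    using normal_at_bounds[of T v "lstat \<sigma> v" "rstat (2 * n) \<sigma> v"] X_perms_slots(2)[OF X(1) that]
      normalized_iff[OF assms(1) T(1)] assms(3) that X(2) by auto
  note stats = stat_31_2_eq_sum[OF X_perms_permutes[OF X(1)]] stat_2_31_eq_sum[OF X_perms_permutes[OF X(1)]]
  note k = sum_opens[OF T(1), unfolded T(2), symmetric]
  show "k \<le> stat_31_2 (2 * n) \<sigma>" unfolding stats k(2) by (rule sum_mono) (rule bound)
  show "k \<le> stat_2_31 (2 * n) \<sigma>" unfolding stats k(1) by (rule sum_mono) (rule bound)
  show "stat_31_2 (2 * n) \<sigma> - k = (\<Sum>v\<in>{1..2 * n}. lstat \<sigma> v - of_bool (closes T v))"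
    unfolding stats k(2) by (rule sum_subtractf_nat[symmetric]) (rule bound)
  show "stat_2_31 (2 * n) \<sigma> - k = (\<Sum>v\<in>{1..2 * n}. rstat (2 * n) \<sigma> v - of_bool (opens T v))"
    unfolding stats k(1) by (rule sum_subtractf_nat[symmetric]) (rule bound)
qed

lemma normalized_fibre_weight:
  fixes p q :: "'a::comm_semiring_1"
  assumes "T \<in> sparse_card n k"
  shows "(p + q) ^ (2 * k) * (\<Sum>\<sigma>\<in>{\<sigma> \<in> fibre n T. normalized n \<sigma>}.
      q ^ (stat_31_2 (2 * n) \<sigma> - k) * p ^ (stat_2_31 (2 * n) \<sigma> - k)) = slot_weight n p q T"
proof -
  let ?I = "{1..2 * n}"
  have T: "T \<in> sparse n" "card (odd_part T) = k" "T \<in> balanced n"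
    using assms by (auto simp: sparse_card_def sparse_def)
  \<comment> \<open>The product of these local weights vanishes as soon as one condition fails, so it selects
     the normalized permutations.\<close>
  let ?h = "\<lambda>v l. normal_weight p q T v l (nat (slots T v) - 1 - l)"
  have fin: "finite (fibre n T)" by (rule finite_subset[OF _ finite_X_perms[of n]]) (auto simp: fibre_def)
  have "(if normalized n \<sigma> then q ^ (stat_31_2 (2 * n) \<sigma> - k) * p ^ (stat_2_31 (2 * n) \<sigma> - k) else 0)
      = (\<Prod>v\<in>?I. ?h v (lstat \<sigma> v))" if \<sigma>: "\<sigma> \<in> fibre n T" for \<sigma>
  proof -
    have h: "(\<Prod>v\<in>?I. ?h v (lstat \<sigma> v))
        = (\<Prod>v\<in>?I. normal_weight p q T v (lstat \<sigma> v) (rstat (2 * n) \<sigma> v))"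
      using rstat_eq[OF \<sigma>] by (intro prod.cong) auto
    show ?thesis
    proof (cases "normalized n \<sigma>")
      case True
      then have "(\<Prod>v\<in>?I. normal_weight p q T v (lstat \<sigma> v) (rstat (2 * n) \<sigma> v))
          = (\<Prod>v\<in>?I. q ^ (lstat \<sigma> v - of_bool (closes T v))
               * p ^ (rstat (2 * n) \<sigma> v - of_bool (opens T v)))"
        unfolding normalized_iff[OF \<sigma> T(1)]
        by (intro prod.cong refl) (simp only: normal_weight_def if_True)
      with True show ?thesis
        by (simp only: h normalized_stats[OF \<sigma> assms True] power_sum prod.distrib if_True)
    next
      case False
      then obtain v where "v \<in> ?I" "\<not> normal_at T v (lstat \<sigma> v) (rstat (2 * n) \<sigma> v)"
        unfolding normalized_iff[OF \<sigma> T(1)] by blast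
      then have "(\<Prod>v\<in>?I. normal_weight p q T v (lstat \<sigma> v) (rstat (2 * n) \<sigma> v)) = 0"
        by (intro prod_zero bexI[of _ v]) (simp_all add: normal_weight_def)
      with False show ?thesis by (simp only: h if_False)
    qed
  qed
  then have "(\<Sum>\<sigma>\<in>{\<sigma> \<in> fibre n T. normalized n \<sigma>}.
        q ^ (stat_31_2 (2 * n) \<sigma> - k) * p ^ (stat_2_31 (2 * n) \<sigma> - k))
      = (\<Sum>\<sigma>\<in>fibre n T. \<Prod>v\<in>?I. ?h v (lstat \<sigma> v))"
    unfolding sum.inter_filter[OF fin] by (intro sum.cong refl)
  also have "\<dots> = (\<Prod>v\<in>?I. \<Sum>l<nat (slots T v). ?h v l)" by (rule sum_fibre[OF T(3)])
  finally have eq: "(\<Sum>\<sigma>\<in>{\<sigma> \<in> fibre n T. normalized n \<sigma>}.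
        q ^ (stat_31_2 (2 * n) \<sigma> - k) * p ^ (stat_2_31 (2 * n) \<sigma> - k))
      = (\<Prod>v\<in>?I. \<Sum>l<nat (slots T v). ?h v l)" .
  have "2 * k = (\<Sum>v\<in>?I. of_bool (opens T v) + of_bool (closes T v))"
    using sum_opens[OF T(1)] T(2) by (simp add: sum.distrib)
  then have pow: "(p + q) ^ (2 * k) = (\<Prod>v\<in>?I. (p + q) ^ (of_bool (opens T v) + of_bool (closes T v)))"
    by (simp only: power_sum)
  show ?thesis
    unfolding eq slot_weight_def pow prod.distrib[symmetric]
    by (rule prod.cong[OF refl]) (rule sum_normal_weight[OF T(1)])
qed

theorem theorem13:
  fixes n :: nat and p q t :: "'a::comm_ring_1"
  assumes "n \<ge> 1"
  shows "(\<Sum>\<sigma> \<in> X_perms n. p ^ stat_2_31 (2 * n) \<sigma> * q ^ stat_31_2 (2 * n) \<sigma> * t ^ des (2 * n) \<sigma>)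
           = (\<Sum>k = 0..n div 2. gamma_coeff n k p q * t ^ k * (1 + t) ^ (n - 2 * k))
    \<and> (\<forall>k \<le> n div 2.
          (\<forall>\<sigma> \<in> N_perms_des n k. k \<le> stat_31_2 (2 * n) \<sigma> \<and> k \<le> stat_2_31 (2 * n) \<sigma>)
        \<and> gamma_coeff n k p q
            = (p + q) ^ (2 * k) *
              (\<Sum>\<sigma> \<in> N_perms_des n k.
                 q ^ (stat_31_2 (2 * n) \<sigma> - k) * p ^ (stat_2_31 (2 * n) \<sigma> - k)))"
proof (intro conjI allI impI ballI)
  have "card (odd_part T) \<in> {0..n div 2}" if "T \<in> sparse n" for T
    using card_free_pairs[OF that] by simp
  then have range: "(\<lambda>T. card (odd_part T)) ` sparse n \<subseteq> {0..n div 2}" by blast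
  have "(\<Sum>\<sigma>\<in>X_perms n. p ^ stat_2_31 (2 * n) \<sigma> * q ^ stat_31_2 (2 * n) \<sigma> * t ^ des (2 * n) \<sigma>)
      = (\<Sum>T\<in>sparse n. t ^ card (odd_part T) * (1 + t) ^ (n - 2 * card (odd_part T)) * slot_weight n p q T)"
    unfolding sum_X_perms by (rule sum_balanced_eq_sum_sparse)
  also have "\<dots> = (\<Sum>k = 0..n div 2. \<Sum>T\<in>sparse_card n k.
      t ^ card (odd_part T) * (1 + t) ^ (n - 2 * card (odd_part T)) * slot_weight n p q T)"
    unfolding sparse_card_def by (rule sum.group[OF finite_sparse _ range, symmetric]) simp
  also have "\<dots> = (\<Sum>k = 0..n div 2. gamma_coeff n k p q * t ^ k * (1 + t) ^ (n - 2 * k))"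
    unfolding gamma_coeff_eq_sum sum_distrib_right
    by (intro sum.cong refl) (simp add: sparse_card_def ac_simps)
  finally show "(\<Sum>\<sigma> \<in> X_perms n. p ^ stat_2_31 (2 * n) \<sigma> * q ^ stat_31_2 (2 * n) \<sigma> * t ^ des (2 * n) \<sigma>)
      = (\<Sum>k = 0..n div 2. gamma_coeff n k p q * t ^ k * (1 + t) ^ (n - 2 * k))" .
next
  fix k \<sigma> assume "\<sigma> \<in> N_perms_des n k"
  then have X: "\<sigma> \<in> X_perms n" and \<sigma>: "\<sigma> \<in> E_perms n" "normalized n \<sigma>" "des (2 * n) \<sigma> = k"
    by (auto simp: N_perms_des_def E_perms_def)
  then have "\<sigma> \<in> fibre n (S_set n \<sigma>)" "S_set n \<sigma> \<in> sparse_card n k"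
    using E_perms_iff[OF X] des_eq_card_odd_part[OF X] by (simp_all add: fibre_def sparse_card_def)
  from normalized_stats(1,2)[OF this \<sigma>(2)]
  show "k \<le> stat_31_2 (2 * n) \<sigma>" "k \<le> stat_2_31 (2 * n) \<sigma>" .
next
  fix k
  have "(\<Sum>\<sigma>\<in>N_perms_des n k. q ^ (stat_31_2 (2 * n) \<sigma> - k) * p ^ (stat_2_31 (2 * n) \<sigma> - k))
      = (\<Sum>T\<in>sparse_card n k. \<Sum>\<sigma>\<in>{\<sigma> \<in> fibre n T. normalized n \<sigma>}.
          q ^ (stat_31_2 (2 * n) \<sigma> - k) * p ^ (stat_2_31 (2 * n) \<sigma> - k))"
    unfolding sum_over_sparse_fibres[symmetric]
    by (intro sum.cong) (auto simp: N_perms_des_def E_perms_des_def)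
  then show "gamma_coeff n k p q = (p + q) ^ (2 * k) *
      (\<Sum>\<sigma>\<in>N_perms_des n k. q ^ (stat_31_2 (2 * n) \<sigma> - k) * p ^ (stat_2_31 (2 * n) \<sigma> - k))"
    by (simp add: sum_distrib_left[of _ _ "sparse_card n k"] normalized_fibre_weight gamma_coeff_eq_sum)
qed

end
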